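(* Let $w=\varepsilon_1\ldots\varepsilon_k$ be a non-empty admissible binary word. For all integers $m\ge0$ and $n\ge0$, $$\zeta(w)_{m,n}=\sum_{M=1}^{\infty}\binom{m+n+2M}{m+M}^{-1}\sum_{i=1}^{k-1}\varphi_{m,m+M}(\mathbf b_i)\,\varphi_{n,n+M}(\mathbf a_i)\,\lambda_{m+M,n+M}(\varepsilon_i,\varepsilon_{i+1}).$$
   Context: A binary word is a finite word over $\{0,1\}$; it is admissible if empty or it starts with $0$ and ends with $1$. A composition is a finite sequence of positive integers; its binary word is $\mathbf w(a_1,\ldots,a_r)=\{0\}_{a_1-1}1\cdots\{0\}_{a_r-1}1$ ($\{0\}_u$ = $u$ letters $0$), a bijection onto binary words that are empty or end with $1$. $\overline0=1,\overline1=0$. Set $f_0(t)=1/t$, $f_1(t)=1/(1-t)$, and $\zeta(w)_{m,n}=\int_{1>t_1>\cdots>t_k>0}(1-t_1)^m f_{\varepsilon_1}(t_1)\cdots f_{\varepsilon_k}(t_k)t_k^n\,dt_1\cdots dt_k$. For a non-empty composition $\mathbf c=(c_1,\ldots,c_r)$ and integers $0\le p<q$: $\varphi_{p,q}(\mathbf c)=q^{-c_1}\sum_{q>n_2>\cdots>n_r>p}n_2^{-c_2}\cdots n_r^{-c_r}$ (equal to $q^{-c_1}$ if $r=1$). For $1\le i\le k-1$, $\mathbf a_i$ is the composition with binary word $\varepsilon_{i+1}\ldots\varepsilon_k$ and $\mathbf b_i$ the composition with binary word $\overline{\varepsilon_i}\ldots\overline{\varepsilon_1}$. For bits $\varepsilon,\varepsilon'$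 and positive integers $p,q$: $\lambda_{p,q}(\varepsilon,\varepsilon')=1+\delta+\delta'$ where $\delta=p/q$ if $\varepsilon=0$, $\delta=0$ if $\varepsilon=1$, and $\delta'=q/p$ if $\varepsilon'=1$, $\delta'=0$ if $\varepsilon'=0$. *)

theory Defs
  imports "HOL-Analysis.Analysis" "HOL-Library.Z2"
begin

type_synonym binary_word = "bit list"

definition admissible :: "binary_word \<Rightarrow> bool" where
  "admissible w \<longleftrightarrow> w = [] \<or> (hd w = 0 \<and> last w = 1)"

definition bit_compl :: "bit \<Rightarrow> bit" where
  "bit_compl e = (if e = 0 then 1 else 0)"

definition is_composition :: "nat list \<Rightarrow> bool" where
  "is_composition c \<longleftrightarrow> (\<forall>a\<in>set c. 0 < a)"

definition comp_word :: "nat list \<Rightarrow> binary_word" where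
  "comp_word c = concat (map (\<lambda>a. replicate (a - 1) 0 @ [1]) c)"

definition word_comp :: "binary_word \<Rightarrow> nat list" where
  "word_comp w = (THE c. is_composition c \<and> comp_word c = w)"

definition comp_a :: "binary_word \<Rightarrow> nat \<Rightarrow> nat list" where
  "comp_a w i = word_comp (drop i w)"

definition comp_b :: "binary_word \<Rightarrow> nat \<Rightarrow> nat list" where
  "comp_b w i = word_comp (map bit_compl (rev (take i w)))"

definition form_fun :: "bit \<Rightarrow> real \<Rightarrow> real" where
  "form_fun e t = (if e = 0 then 1 / t else 1 / (1 - t))"

definition open_simplex :: "nat \<Rightarrow> (nat \<Rightarrow> real) set" where
  "open_simplex k = {t \<in> {1..k} \<rightarrow>\<^sub>E UNIV.
     (\<forall>i\<in>{1..k}. 0 < t i \<and> t i < 1) \<and> (\<forall>i\<in>{1..<k}. t (i + 1) < t i)}"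

text \<open>
  Letters of a word are numbered from 1, so the i-th letter of \<open>w\<close> is \<open>w ! (i - 1)\<close>.
  The definition is meant for non-empty words only.
\<close>

definition zeta_mn :: "binary_word \<Rightarrow> nat \<Rightarrow> nat \<Rightarrow> real" where
  "zeta_mn w m n =
     (let k = length w in
      LINT t:open_simplex k | (\<Pi>\<^sub>M i\<in>{1..k}. lborel).
        (1 - t 1) ^ m * (\<Prod>i=1..k. form_fun (w ! (i - 1)) (t i)) * t k ^ n)"

text \<open>
  The list \<open>ns\<close> below is the tuple of the summation variables \<open>n\<^sub>2, \<dots>, n\<^sub>r\<close>;
  for \<open>r = 1\<close> and \<open>p < q\<close> it ranges over the singleton containing the empty list.
\<close>

definition phi :: "nat \<Rightarrow> nat \<Rightarrow> nat list \<Rightarrow> real" where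
  "phi p q c = 1 / real q ^ hd c *
     (\<Sum>ns | length ns = length c - 1 \<and> sorted_wrt (>) (q # ns @ [p]).
        \<Prod>j<length c - 1. 1 / real (ns ! j) ^ (c ! (j + 1)))"

definition lam :: "nat \<Rightarrow> nat \<Rightarrow> bit \<Rightarrow> bit \<Rightarrow> real" where
  "lam p q e e' = 1 + (if e = 0 then real p / real q else 0)
                    + (if e' = 1 then real q / real p else 0)"


lemma finite_phi_index:
  "finite {ns. length ns = r \<and> sorted_wrt (>) (q # ns @ [p :: nat])}"
proof (rule finite_subset)
  show "{ns. length ns = r \<and> sorted_wrt (>) (q # ns @ [p])}
          \<subseteq> {ns. set ns \<subseteq> {..q} \<and> length ns = r}"
    by auto
  show "finite {ns. set ns \<subseteq> {..q} \<and> length ns = r}"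
    by (rule finite_lists_length_eq) simp
qed

lemma phi_single: "p < q \<Longrightarrow> phi p q [c] = 1 / real q ^ c"
proof -
  assume "p < q"
  then have "{ns. length ns = 0 \<and> sorted_wrt (>) (q # ns @ [p])} = {[]}"
    by auto
  then show ?thesis by (simp add: phi_def)
qed

lemma comp_word_Nil [simp]: "comp_word [] = []"
  by (simp add: comp_word_def)

lemma comp_word_Cons [simp]: "comp_word (a # c) = replicate (a - 1) 0 @ 1 # comp_word c"
  by (simp add: comp_word_def)

lemma replicate_zero_one_eqD:
  "replicate a (0::bit) @ 1 # u = replicate b 0 @ 1 # v \<Longrightarrow> a = b \<and> u = v"
proof (induction a arbitrary: b)
  case 0
  then show ?case by (cases b) auto
next
  case (Suc a)
  then show ?case by (cases b) auto
qed

lemma comp_word_inj: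
  "is_composition c \<Longrightarrow> is_composition d \<Longrightarrow> comp_word c = comp_word d \<Longrightarrow> c = d"
proof (induction c arbitrary: d)
  case Nil
  then show ?case by (cases d) auto
next
  case (Cons a c)
  then obtain b d' where d: "d = b # d'" by (cases d) auto
  with Cons.prems have "a - 1 = b - 1" "comp_word c = comp_word d'"
    by (auto dest: replicate_zero_one_eqD)
  moreover have "a > 0" "b > 0" "is_composition c" "is_composition d'"
    using Cons.prems d by (auto simp: is_composition_def)
  ultimately show ?case using Cons.IH[of d'] d by auto
qed

lemma comp_word_surj:
  "w = [] \<or> last w = 1 \<Longrightarrow> \<exists>c. is_composition c \<and> comp_word c = w"
proof (induction w)
  case Nil
  show ?case by (intro exI[of _ "[]"]) (simp add: is_composition_def)
next
  case (Cons e w)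
  then obtain c where c: "is_composition c" "comp_word c = w"
    by (cases "w = []") auto
  show ?case
  proof (cases "e = 1")
    case True
    with c show ?thesis
      by (intro exI[of _ "1 # c"]) (auto simp: is_composition_def)
  next
    case False
    then have e: "e = 0" by (cases e) auto
    with Cons.prems have "w \<noteq> []" by auto
    with c obtain a d where ad: "c = a # d" by (cases c) auto
    with c have "a > 0" by (simp add: is_composition_def)
    then have "replicate a (0::bit) = 0 # replicate (a - 1) 0"
      by (cases a) auto
    with ad c e show ?thesis
      by (intro exI[of _ "Suc a # d"]) (auto simp: is_composition_def)
  qed
qed

lemma word_comp_props:
  assumes "w = [] \<or> last w = 1"
  shows "is_composition (word_comp w)" "comp_word (word_comp w) = w"
proof -
  have "\<exists>!c. is_composition c \<and> comp_word c = w"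
    using comp_word_surj[OF assms] comp_word_inj by blast
  from theI'[OF this] show "is_composition (word_comp w)" "comp_word (word_comp w) = w"
    by (simp_all add: word_comp_def)
qed

end

theory Submission
  imports Defs
begin

text \<open>
  Integrating out \<open>t\<^sub>k\<close> or \<open>t\<^sub>1\<close> shows that a last letter \<open>0\<close> of \<open>x\<close> contributes a factor \<open>1/q\<close>
  to \<open>\<zeta>(x)\<^sub>p\<^sub>,\<^sub>q\<close>, that \<open>\<zeta>(v1)\<^sub>p\<^sub>,\<^sub>q\<^sub>-\<^sub>1 = \<zeta>(v1)\<^sub>p\<^sub>,\<^sub>q + \<zeta>(v)\<^sub>p\<^sub>,\<^sub>q / q\<close>, and dually for first letters;
  this forces \<open>\<zeta>\<close> of the empty word to be the inverse binomial coefficient.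
  Peel \<open>w\<close> from both ends while raising both indices by one at a time. After \<open>M\<close> steps
  \<open>\<zeta>(w)\<^sub>m\<^sub>,\<^sub>n\<close> is a sum of contributions of the empty word, which make up the first \<open>M\<close> terms of the
  series, plus a remainder: a combination of the values \<open>\<zeta>(x)\<^sub>m\<^sub>+\<^sub>M\<^sub>,\<^sub>n\<^sub>+\<^sub>M\<close> over the non-empty
  admissible factors \<open>x\<close> of \<open>w\<close>, with truncated multiple harmonic sums as coefficients.
  Since \<open>(1 - t\<^sub>1) t\<^sub>k \<le> 1/4\<close> on the simplex, the values decay like \<open>4\<^sup>-\<^sup>M\<close>, whereas the
  coefficients grow more slowly than any exponential.
\<close>

section \<open>Truncated multiple harmonic sums indexed by words\<close>

text \<open>Letterwise form of \<open>phi\<close>: a letter 0 raises the exponent of the current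
  summation variable, a letter 1 completes it and passes to a smaller variable. The term
  \<open>of_bool (s = [])\<close> is the empty product after the last 1. The value 0 for the empty
  word makes the contributions of the two outermost cuts of a word drop out.\<close>

primrec phi_word :: "nat \<Rightarrow> bit list \<Rightarrow> nat \<Rightarrow> real" where
  "phi_word p [] q = 0"
| "phi_word p (e # s) q =
     (if e = 0 then phi_word p s q else of_bool (s = []) + (\<Sum>r\<in>{p<..<q}. phi_word p s r)) / real q"

text \<open>These sums become the coefficients of the remainder: the range is closed at
  \<open>q\<close> and the leading denominator is missing, so that raising \<open>q\<close> by one
  adds exactly one value of \<open>phi_word\<close>.\<close>

definition tail_sum :: "nat \<Rightarrow> bit list \<Rightarrow> nat \<Rightarrow> real" where
  "tail_sum p s q = of_bool (s = []) + (\<Sum>r\<in>{p<..q}. phi_word p s r)"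

lemma phi_word_one: "phi_word p (1 # s) (Suc q) = tail_sum p s q / real (Suc q)"
proof -
  have "{p<..<Suc q} = {p<..q}" by auto
  then show ?thesis by (simp add: tail_sum_def)
qed

lemma phi_word_zero: "phi_word p (0 # s) q = phi_word p s q / real q"
  by simp

lemma tail_sum_Suc: "p \<le> q \<Longrightarrow> tail_sum p s (Suc q) = tail_sum p s q + phi_word p s (Suc q)"
proof -
  assume "p \<le> q"
  then have "{p<..Suc q} = insert (Suc q) {p<..q}" by auto
  then show ?thesis by (simp add: tail_sum_def)
qed

lemma tail_sum_self: "tail_sum p s p = of_bool (s = [])"
  by (simp add: tail_sum_def)

section \<open>Non-negativity and growth of the truncated sums\<close>

lemma phi_word_nonneg: "0 \<le> phi_word p s q"
  by (induction s arbitrary: q) (auto intro!: sum_nonneg divide_nonneg_nonneg)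

lemma tail_sum_nonneg: "0 \<le> tail_sum p s q"
  by (simp add: tail_sum_def sum_nonneg phi_word_nonneg)

lemma sum_power_three_halves_le: "(\<Sum>r\<in>{p<..<q}. (3/2::real) ^ r) \<le> 2 * (3/2) ^ q"
proof -
  have "(\<Sum>r\<in>{p<..<q}. (3/2::real) ^ r) \<le> (\<Sum>r<q. (3/2::real) ^ r)"
    by (rule sum_mono2) auto
  also have "\<dots> \<le> 2 * (3/2) ^ q"
    by (simp add: geometric_sum)
  finally show ?thesis .
qed

text \<open>The base only has to lie strictly between 1 and 2, since two such powers will meet the
  decay \<open>4 ^ M\<close>. For 3/2 the geometric sum together with the term
  \<open>of_bool\<close> costs at most a factor 3 per letter.\<close>

lemma phi_word_le: "phi_word p s q \<le> 3 ^ length s * (3/2) ^ q"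
proof (induction s arbitrary: q)
  case Nil
  show ?case by simp
next
  case (Cons e s)
  define B where "B = (3::real) ^ length s"
  have B: "B \<ge> 1" and a: "(3/2::real) ^ q \<ge> 1" by (simp_all add: B_def)
  have IH: "phi_word p s r \<le> B * (3/2) ^ r" for r using Cons by (simp add: B_def)
  have "(\<Sum>r\<in>{p<..<q}. phi_word p s r) \<le> (\<Sum>r\<in>{p<..<q}. B * (3/2) ^ r)"
    by (rule sum_mono) (rule IH)
  also have "\<dots> = B * (\<Sum>r\<in>{p<..<q}. (3/2) ^ r)" by (simp add: sum_distrib_left)
  also have "\<dots> \<le> B * (2 * (3/2) ^ q)"
    using B by (intro mult_left_mono sum_power_three_halves_le) auto
  finally have s: "(\<Sum>r\<in>{p<..<q}. phi_word p s r) \<le> 2 * (B * (3/2) ^ q)" by simp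
  have B1: "1 \<le> B * (3/2) ^ q" using mult_mono[OF B a] B by simp
  define N where "N = (if e = 0 then phi_word p s q else of_bool (s = []) + (\<Sum>r\<in>{p<..<q}. phi_word p s r))"
  have N: "N \<le> 3 * (B * (3/2) ^ q)" "0 \<le> N"
    using s B1 IH[of q] by (auto simp: N_def sum_nonneg phi_word_nonneg)
  \<comment> \<open>For \<open>q = 0\<close> the quotient is 0 by convention; otherwise the divisor
    is at least 1.\<close>
  have "N / real q \<le> N"
    using N(2) mult_left_mono[of 1 "real q" N] by (cases "q = 0") (auto simp: divide_le_eq)
  then show ?case using N by (simp add: N_def[symmetric] B_def)
qed

text \<open>Closing the range at \<open>q\<close> turns the factor 2 into 3; with the term
  \<open>of_bool\<close> the total stays below \<open>3 ^ 2\<close>, hence the two extra powers of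
  3.\<close>

lemma tail_sum_le: "tail_sum p s q \<le> 3 ^ (length s + 2) * (3/2) ^ q"
proof -
  define B where "B = (3::real) ^ length s"
  have B: "B \<ge> 1" and a: "(3/2::real) ^ q \<ge> 1" by (simp_all add: B_def)
  have B1: "1 \<le> B * (3/2) ^ q" using mult_mono[OF B a] B by simp
  have "(\<Sum>r\<in>{p<..q}. phi_word p s r) = (\<Sum>r\<in>{p<..<Suc q}. phi_word p s r)"
    by (intro sum.cong) auto
  also have "\<dots> \<le> (\<Sum>r\<in>{p<..<Suc q}. B * (3/2) ^ r)"
    unfolding B_def by (rule sum_mono) (rule phi_word_le)
  also have "\<dots> = B * (\<Sum>r\<in>{p<..<Suc q}. (3/2) ^ r)" by (simp add: sum_distrib_left)
  also have "\<dots> \<le> B * (2 * (3/2) ^ Suc q)"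
    using B by (intro mult_left_mono sum_power_three_halves_le) auto
  finally have "(\<Sum>r\<in>{p<..q}. phi_word p s r) \<le> 3 * (B * (3/2) ^ q)" by simp
  then have "tail_sum p s q \<le> 9 * (B * (3/2) ^ q)" using B1 by (auto simp: tail_sum_def)
  then show ?thesis by (simp add: B_def power_add)
qed

section \<open>Agreement of the letterwise sums with \<open>phi\<close>\<close>

lemma phi_word_replicate_zero: "phi_word p (replicate a 0 @ s) q = phi_word p s q / real q ^ a"
  by (induction a) (auto simp: field_simps)

text \<open>Splitting off the head \<open>r\<close> of \<open>ns\<close> leaves a decreasing list
  between \<open>p\<close> and \<open>r\<close>, that is, a member of the index set of
  \<open>phi p r\<close>.\<close>

lemma phi_Cons:
  "phi p q (a # b # c) = 1 / real q ^ a * (\<Sum>r\<in>{p<..<q}. phi p r (b # c))"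
proof -
  let ?I = "\<lambda>q l. {ns. length ns = l \<and> sorted_wrt (>) (q # ns @ [p])}"
  let ?g = "\<lambda>c ns. \<Prod>j<length c. 1 / real (ns ! j) ^ (c ! j)"
  have I: "?I q (Suc (length c)) = (\<lambda>(r, ns). r # ns) ` (SIGMA r:{p<..<q}. ?I r (length c))"
  proof (rule set_eqI)
    fix ns
    show "ns \<in> ?I q (Suc (length c)) \<longleftrightarrow>
      ns \<in> (\<lambda>(r, ns). r # ns) ` (SIGMA r:{p<..<q}. ?I r (length c))"
      by (cases ns) (auto simp: image_iff)
  qed
  have "phi p q (a # b # c) = 1 / real q ^ a * (\<Sum>ns\<in>?I q (Suc (length c)). ?g (b # c) ns)"
    by (simp add: phi_def)
  also have "(\<Sum>ns\<in>?I q (Suc (length c)). ?g (b # c) ns)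
      = (\<Sum>(r, ns)\<in>(SIGMA r:{p<..<q}. ?I r (length c)). ?g (b # c) (r # ns))"
    unfolding I by (subst sum.reindex) (auto simp: inj_on_def case_prod_unfold)
  also have "\<dots> = (\<Sum>r\<in>{p<..<q}. \<Sum>ns\<in>?I r (length c). ?g (b # c) (r # ns))"
    by (subst sum.Sigma) (auto intro: finite_phi_index simp del: sorted_wrt.simps)
  also have "\<dots> = (\<Sum>r\<in>{p<..<q}. phi p r (b # c))"
    by (simp add: phi_def prod.lessThan_Suc_shift sum_distrib_left del: prod.lessThan_Suc)
  finally show ?thesis .
qed

text \<open>A part \<open>a\<close> is spelled with \<open>a - 1\<close> zeros and a 1. The zeros
  give \<open>a - 1\<close> factors \<open>1 / q\<close>, the 1 gives the last such factor and,
  unless it ends the word, the sum over the next variable.\<close>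

lemma phi_eq_phi_word:
  assumes "is_composition c" "c \<noteq> []" "p < q"
  shows "phi p q c = phi_word p (comp_word c) q"
  using assms
proof (induction c arbitrary: q)
  case Nil
  then show ?case by simp
next
  case (Cons a c)
  then have a: "real q ^ a = real q ^ (a - 1) * real q"
    by (cases a) (auto simp: is_composition_def)
  show ?case
  proof (cases c)
    case Nil
    then show ?thesis using Cons.prems a
      by (auto simp: phi_single phi_word_replicate_zero)
  next
    case c: (Cons b d)
    have "(\<Sum>r\<in>{p<..<q}. phi p r c) = (\<Sum>r\<in>{p<..<q}. phi_word p (comp_word c) r)"
      using Cons c by (intro sum.cong) (auto simp: is_composition_def)
    moreover have "comp_word c \<noteq> []" using c by simp
    ultimately have "phi p q (a # c) = phi_word p (comp_word (a # c)) q"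
      unfolding c phi_Cons using a by (simp add: phi_word_replicate_zero c)
    then show ?thesis .
  qed
qed

lemma phi_word_comp:
  assumes "s \<noteq> []" "last s = 1" "p < q"
  shows "phi p q (word_comp s) = phi_word p s q"
proof -
  have w: "is_composition (word_comp s)" "comp_word (word_comp s) = s"
    using assms word_comp_props by auto
  with assms have "word_comp s \<noteq> []" by auto
  with w assms show ?thesis by (simp add: phi_eq_phi_word)
qed

text \<open>Summation by parts while the right index is raised. \<open>A\<close> stands for zeta
  values of factors with right end \<open>j\<close> at the old index, \<open>z\<close> for those at
  the new one. Whatever its letter, position \<open>j\<close> accounts for \<rho>(j-1) z(j-1) -
  \<rho>(j) z(j). The sum telescopes, and only the term of the empty factor at \<open>i\<close>
  survives.\<close>

lemma right_peeling_sum: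
  fixes T \<rho> A z :: "nat \<Rightarrow> real"
  assumes "i \<le> k" "\<rho> k = 0"
    and one: "\<And>j. i < j \<Longrightarrow> j \<le> k \<Longrightarrow> e j \<Longrightarrow> A j = z j + z (j - 1) / q \<and> \<rho> (j - 1) = T j / q"
    and zero: "\<And>j. i < j \<Longrightarrow> j \<le> k \<Longrightarrow> \<not> e j \<Longrightarrow> z j = z (j - 1) / q \<and> \<rho> (j - 1) = \<rho> j / q"
  shows "(\<Sum>j | i < j \<and> j \<le> k \<and> e j. T j * A j)
       = (\<Sum>j | i < j \<and> j \<le> k \<and> e j. (T j + \<rho> j) * z j) + \<rho> i * z i"
proof -
  have set: "{j. i < j \<and> j \<le> k \<and> e j} = {j\<in>{i<..k}. e j}" by auto
  have "(\<Sum>j\<in>{i<..k}. if e j then T j * A j - (T j + \<rho> j) * z j else 0)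
      = (\<Sum>j\<in>{i<..k}. \<rho> (j - 1) * z (j - 1) - \<rho> j * z j)"
  proof (intro sum.cong refl)
    fix j assume "j \<in> {i<..k}"
    then have "i < j" "j \<le> k" by auto
    from one[OF this] zero[OF this]
    show "(if e j then T j * A j - (T j + \<rho> j) * z j else 0) = \<rho> (j - 1) * z (j - 1) - \<rho> j * z j"
      by (cases "e j") (simp_all add: algebra_simps)
  qed
  also have "\<dots> = (\<Sum>j\<in>{i..<k}. \<rho> j * z j - \<rho> (Suc j) * z (Suc j))"
    by (intro sum.reindex_bij_witness[of _ Suc "\<lambda>j. j - 1"]) auto
  also have "\<dots> = \<rho> i * z i - \<rho> k * z k"
    using sum_Suc_diff'[OF assms(1), of "\<lambda>j. - (\<rho> j * z j)"] by simp
  finally have "(\<Sum>j\<in>{j\<in>{i<..k}. e j}. T j * A j - (T j + \<rho> j) * z j) = \<rho> i * z i"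
    by (subst sum.inter_filter) (simp_all add: assms(2))
  then show ?thesis
    unfolding set sum_subtractf by linarith
qed

text \<open>Mirror image for the left index: the telescoping runs from the cut 0, where \<sigma>
  vanishes, up to the empty factor at \<open>j\<close>.\<close>

lemma left_peeling_sum:
  fixes U \<sigma> A y :: "nat \<Rightarrow> real"
  assumes "\<sigma> 0 = 0"
    and one: "\<And>i. i < j \<Longrightarrow> e i \<Longrightarrow> A i = y i + y (Suc i) / p \<and> \<sigma> (Suc i) = U i / p"
    and zero: "\<And>i. i < j \<Longrightarrow> \<not> e i \<Longrightarrow> y i = y (Suc i) / p \<and> \<sigma> (Suc i) = \<sigma> i / p"
  shows "(\<Sum>i | i < j \<and> e i. U i * A i)
       = (\<Sum>i | i < j \<and> e i. (U i + \<sigma> i) * y i) + \<sigma> j * y j"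
proof -
  have set: "{i. i < j \<and> e i} = {i\<in>{..<j}. e i}" by auto
  have "(\<Sum>i\<in>{..<j}. if e i then U i * A i - (U i + \<sigma> i) * y i else 0)
      = (\<Sum>i\<in>{..<j}. \<sigma> (Suc i) * y (Suc i) - \<sigma> i * y i)"
  proof (intro sum.cong refl)
    fix i assume "i \<in> {..<j}"
    then have "i < j" by auto
    from one[OF this] zero[OF this]
    show "(if e i then U i * A i - (U i + \<sigma> i) * y i else 0) = \<sigma> (Suc i) * y (Suc i) - \<sigma> i * y i"
      by (cases "e i") (simp_all add: algebra_simps)
  qed
  also have "\<dots> = \<sigma> j * y j - \<sigma> 0 * y 0"
    by (rule sum_lessThan_telescope)
  finally have "(\<Sum>i\<in>{i\<in>{..<j}. e i}. U i * A i - (U i + \<sigma> i) * y i) = \<sigma> j * y j"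
    by (subst sum.inter_filter) (simp_all add: assms(1))
  then show ?thesis
    unfolding set sum_subtractf by linarith
qed

section \<open>Iterated integrals and their recursions\<close>

definition pint :: "bit \<Rightarrow> (real \<Rightarrow> ennreal) \<Rightarrow> real \<Rightarrow> ennreal" where
  "pint e g t = (\<integral>\<^sup>+ s. ennreal (form_fun e s) * g s * indicator {0<..<t} s \<partial>lborel)"

definition wint :: "nat \<Rightarrow> bit \<Rightarrow> (real \<Rightarrow> ennreal) \<Rightarrow> ennreal" where
  "wint m e g = (\<integral>\<^sup>+ t. ennreal ((1 - t) ^ m * form_fun e t) * g t * indicator {0<..<1} t \<partial>lborel)"

text \<open>
  \<open>pint\<close> integrates out an inner variable, \<open>wint\<close> the outermost one. Working in \<^typ>\<open>ennreal\<close> makes the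
  recursions for \<open>ezeta\<close> independent of convergence.
\<close>

fun ezeta :: "bit list \<Rightarrow> nat \<Rightarrow> nat \<Rightarrow> ennreal" where
  "ezeta [] m n = ennreal (1 / real ((m + n) choose m))"
| "ezeta (e # v) m n = wint m e (foldr pint v (\<lambda>t. ennreal (t ^ n)))"

section \<open>Measurability, monotonicity and linearity of the integral operators\<close>

lemma form_fun_nonneg: "0 < t \<Longrightarrow> t < 1 \<Longrightarrow> 0 \<le> form_fun e t"
  by (simp add: form_fun_def)

lemma measurable_form_fun [measurable]: "form_fun e \<in> borel_measurable borel"
  unfolding form_fun_def[abs_def] by measurable

lemma measurable_pint [measurable]:
  assumes [measurable]: "g \<in> borel_measurable borel"
  shows "pint e g \<in> borel_measurable borel"
  unfolding pint_def[abs_def] indicator_def greaterThanLessThan_iff by measurable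

lemma measurable_foldr_pint [measurable]:
  "g \<in> borel_measurable borel \<Longrightarrow> foldr pint v g \<in> borel_measurable borel"
  by (induction v) auto

lemma pint_mono:
  assumes "t \<le> 1" "\<And>s. 0 < s \<Longrightarrow> s < t \<Longrightarrow> g s \<le> h s"
  shows "pint e g t \<le> pint e h t"
  unfolding pint_def using assms
  by (intro nn_integral_mono) (auto split: split_indicator intro!: mult_left_mono)

lemma foldr_pint_mono:
  assumes "\<And>s. 0 < s \<Longrightarrow> s < 1 \<Longrightarrow> g s \<le> h s" "0 < t" "t < 1"
  shows "foldr pint v g t \<le> foldr pint v h t"
  using assms(2,3)
  by (induction v arbitrary: t) (auto intro!: assms(1) pint_mono)

lemma wint_mono:
  assumes "\<And>s. 0 < s \<Longrightarrow> s < 1 \<Longrightarrow> g s \<le> h s"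
  shows "wint m e g \<le> wint m e h"
  unfolding wint_def using assms
  by (intro nn_integral_mono) (auto split: split_indicator intro!: mult_left_mono)

lemma wint_cong:
  assumes "\<And>s. 0 < s \<Longrightarrow> s < 1 \<Longrightarrow> g s = h s"
  shows "wint m e g = wint m e h"
  using assms by (intro antisym wint_mono) auto

lemma foldr_pint_cong:
  assumes "\<And>s. 0 < s \<Longrightarrow> s < 1 \<Longrightarrow> g s = h s" "0 < t" "t < 1"
  shows "foldr pint v g t = foldr pint v h t"
  using assms by (intro antisym foldr_pint_mono) auto

lemma pint_cmult:
  assumes [measurable]: "g \<in> borel_measurable borel"
  shows "pint e (\<lambda>s. c * g s) t = c * pint e g t"
  unfolding pint_def by (subst nn_integral_cmult[symmetric]) (auto simp: mult_ac)

lemma foldr_pint_cmult: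
  assumes [measurable]: "g \<in> borel_measurable borel"
  shows "foldr pint v (\<lambda>s. c * g s) = (\<lambda>t. c * foldr pint v g t)"
  by (induction v) (auto simp: pint_cmult)

lemma wint_cmult:
  assumes [measurable]: "g \<in> borel_measurable borel"
  shows "wint m e (\<lambda>s. c * g s) = c * wint m e g"
  unfolding wint_def by (subst nn_integral_cmult[symmetric]) (auto simp: mult_ac)

lemma pint_add:
  assumes [measurable]: "g \<in> borel_measurable borel" "h \<in> borel_measurable borel"
  shows "pint e (\<lambda>s. g s + h s) t = pint e g t + pint e h t"
  unfolding pint_def by (subst nn_integral_add[symmetric]) (auto simp: ring_distribs)

lemma foldr_pint_add:
  assumes [measurable]: "g \<in> borel_measurable borel" "h \<in> borel_measurable borel"
  shows "foldr pint v (\<lambda>s. g s + h s) = (\<lambda>t. foldr pint v g t + foldr pint v h t)"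
  by (induction v) (auto simp: pint_add)

lemma wint_add:
  assumes [measurable]: "g \<in> borel_measurable borel" "h \<in> borel_measurable borel"
  shows "wint m e (\<lambda>s. g s + h s) = wint m e g + wint m e h"
  unfolding wint_def by (subst nn_integral_add[symmetric]) (auto simp: ring_distribs)

text \<open>The derivative is required only inside the interval: later integrands such as
  \<open>1 / sqrt t\<close> blow up at an end where their antiderivatives remain continuous.\<close>

lemma nn_integral_FTC_Ioo:
  fixes F f :: "real \<Rightarrow> real"
  assumes "a \<le> b" "continuous_on {a..b} F" "f \<in> borel_measurable borel"
    and "\<And>x. a < x \<Longrightarrow> x < b \<Longrightarrow> (F has_real_derivative f x) (at x)"
    and "\<And>x. a < x \<Longrightarrow> x < b \<Longrightarrow> 0 \<le> f x"
  shows "(\<integral>\<^sup>+ x. ennreal (f x) * indicator {a<..<b} x \<partial>lborel) = ennreal (F b - F a)"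
proof -
  define g where "g x = f x * indicator {a<..<b} x" for x
  have "(f has_integral (F b - F a)) {a..b}"
    using assms by (intro fundamental_theorem_of_calculus_interior)
      (auto simp: has_real_derivative_iff_has_vector_derivative)
  then have "(g has_integral (F b - F a)) {a..b}"
    by (rule has_integral_spike_finite[rotated 2, of _ _ _ "{a,b}"]) (auto simp: g_def)
  moreover have "g \<in> borel_measurable borel" using assms(3) unfolding g_def by measurable
  moreover have "\<And>x. 0 \<le> g x" using assms by (auto simp: g_def indicator_def)
  moreover have "g = (\<lambda>x. if x \<in> {a..b} then g x else 0)"
    by (auto simp: g_def indicator_def fun_eq_iff)
  ultimately have "(\<integral>\<^sup>+ x. ennreal (g x) \<partial>lborel) = ennreal (F b - F a)"
    using has_integral_restrict_UNIV[of "{a..b}" g]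
    by (intro nn_integral_has_integral_lborel) auto
  moreover have "ennreal (g x) = ennreal (f x) * indicator {a<..<b} x" for x
    by (auto simp: g_def indicator_def)
  ultimately show ?thesis by simp
qed

lemma nn_integral_power:
  assumes "0 \<le> t"
  shows "(\<integral>\<^sup>+ s. ennreal (s ^ n) * indicator {0<..<t} s \<partial>lborel) = ennreal (t ^ Suc n / real (Suc n))"
proof -
  have "(\<integral>\<^sup>+ s. ennreal (s ^ n) * indicator {0<..<t} s \<partial>lborel)
      = ennreal (t ^ Suc n / real (Suc n) - 0 ^ Suc n / real (Suc n))"
    using assms
    by (intro nn_integral_FTC_Ioo)
       (auto intro!: derivative_eq_intros continuous_intros simp del: power_Suc)
  then show ?thesis by simp
qed

lemma nn_integral_power_reflect:
  assumes "s \<le> 1"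
  shows "(\<integral>\<^sup>+ t. ennreal ((1 - t) ^ n) * indicator {s<..<1} t \<partial>lborel)
       = ennreal ((1 - s) ^ Suc n / real (Suc n))"
proof -
  have "(\<integral>\<^sup>+ t. ennreal ((1 - t) ^ n) * indicator {s<..<1} t \<partial>lborel)
      = ennreal (- ((1 - 1) ^ Suc n / real (Suc n)) - (- ((1 - s) ^ Suc n / real (Suc n))))"
    using assms
    by (intro nn_integral_FTC_Ioo)
       (auto intro!: derivative_eq_intros continuous_intros simp del: power_Suc)
  then show ?thesis by simp
qed

text \<open>Euler's beta integral. It evaluates the one-letter words, for which no second variable
  is left.\<close>

lemma nn_integral_beta:
  "(\<integral>\<^sup>+ t. ennreal ((1 - t) ^ a * t ^ b) * indicator {0<..<1} t \<partial>lborel)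
   = ennreal (fact a * fact b / fact (a + b + 1))"
proof -
  define g where "g t = (1 - t) ^ a * t ^ b * indicator {0<..<1} t" for t :: real
  have "((\<lambda>t. t powr (real (Suc b) - 1) * (1 - t) powr (real (Suc a) - 1)) has_integral
       Beta (real (Suc b)) (real (Suc a))) {0..1}"
    by (rule has_integral_Beta_real) auto
  then have "(g has_integral Beta (real (Suc b)) (real (Suc a))) {0..1}"
    by (rule has_integral_spike_finite[rotated 2, of _ _ _ "{0,1}"])
       (auto simp: g_def powr_realpow mult_ac)
  moreover have "Beta (real (Suc b)) (real (Suc a)) = fact a * fact b / fact (a + b + 1)"
    using Gamma_fact[of a, where 'a=real] Gamma_fact[of b, where 'a=real]
      Gamma_fact[of "a + b + 1", where 'a=real]
    by (simp add: Beta_def mult_ac add_ac)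
  moreover have "g \<in> borel_measurable borel" unfolding g_def by measurable
  moreover have "\<And>x. 0 \<le> g x" by (auto simp: g_def indicator_def)
  moreover have "g = (\<lambda>x. if x \<in> {0..1} then g x else 0)"
    by (auto simp: g_def indicator_def fun_eq_iff)
  ultimately have "(\<integral>\<^sup>+ x. ennreal (g x) \<partial>lborel)
      = ennreal (fact a * fact b / fact (a + b + 1))"
    using has_integral_restrict_UNIV[of "{0..1}" g]
    by (intro nn_integral_has_integral_lborel) auto
  moreover have "ennreal (g t)
      = ennreal ((1 - t) ^ a * t ^ b) * indicator {0<..<1} t" for t
    by (auto simp: g_def indicator_def)
  ultimately show ?thesis by simp
qed

text \<open>Both forms exhibit the inverse binomial coefficient assigned to the empty word: the
  first serves the word \<open>[0]\<close> with \<open>q = Suc b\<close>, the second the word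
  \<open>[1]\<close> with \<open>p = Suc a\<close>.\<close>

lemma beta_choose:
  "fact a * fact b / fact (a + b + 1) = (1 / real (Suc b)) * (1 / real ((a + Suc b) choose a))"
  "fact a * fact b / fact (a + b + 1) = (1 / real (Suc a)) * (1 / real ((Suc a + b) choose Suc a))"
  by (simp_all add: binomial_fact del: binomial_Suc_Suc)

section \<open>Recursions that remove the last or the first letter\<close>

lemma pint_zero_power:
  assumes "0 \<le> t" "0 < n"
  shows "pint 0 (\<lambda>s. ennreal (s ^ n)) t = ennreal (1 / real n) * ennreal (t ^ n)"
proof -
  obtain l where n: "n = Suc l" using assms by (cases n) auto
  have "pint 0 (\<lambda>s. ennreal (s ^ n)) t = (\<integral>\<^sup>+ s. ennreal (s ^ l) * indicator {0<..<t} s \<partial>lborel)"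
    unfolding pint_def
    by (intro nn_integral_cong)
       (auto simp: form_fun_def n ennreal_mult[symmetric] split: split_indicator)
  also have "\<dots> = ennreal (t ^ n / real n)" using nn_integral_power[OF assms(1)] n by simp
  finally show ?thesis using assms by (simp add: ennreal_mult[symmetric])
qed

text \<open>This is 1/(1-s) = s/(1-s) + 1. Writing the summand 1 as s/s turns it into a letter 0
  with the raised exponent, so the recursion for a final 1 reduces to that for a final 0.\<close>

lemma pint_one_power:
  assumes "t \<le> 1"
  shows "pint 1 (\<lambda>s. ennreal (s ^ n)) t
       = pint 1 (\<lambda>s. ennreal (s ^ Suc n)) t + pint 0 (\<lambda>s. ennreal (s ^ Suc n)) t"
proof -
  have *: "s ^ n / (1 - s) = s ^ Suc n / (1 - s) + s ^ n" if "s < 1" for s :: real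
    using that by (simp add: divide_simps) (simp add: algebra_simps)
  show ?thesis unfolding pint_def using assms *
    by (subst nn_integral_add[symmetric])
       (auto simp: form_fun_def ennreal_mult[symmetric] ennreal_plus[symmetric] simp del: ennreal_plus
          intro!: nn_integral_cong split: split_indicator)
qed

text \<open>The innermost integral of \<open>t ^ (q - 1)\<close> returns the weight
  \<open>t ^ q\<close> of the shorter word, divided by \<open>q\<close>. A single letter has no
  enclosing variable; there the beta integral takes over.\<close>

lemma ezeta_snoc_zero:
  assumes "0 < q"
  shows "ezeta (v @ [0]) p q = ennreal (1 / real q) * ezeta v p q"
proof (cases v)
  case Nil
  obtain b where b: "q = Suc b" using assms by (cases q) auto
  have "ezeta [0] p q = (\<integral>\<^sup>+ t. ennreal ((1 - t) ^ p * t ^ b) * indicator {0<..<1} t \<partial>lborel)"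
    unfolding ezeta.simps foldr.simps wint_def
    by (intro nn_integral_cong)
       (auto simp: form_fun_def b ennreal_mult[symmetric] split: split_indicator)
  then show ?thesis
    unfolding nn_integral_beta beta_choose(1) by (subst (asm) ennreal_mult) (auto simp: Nil b)
next
  case (Cons e u)
  have "foldr pint u (pint 0 (\<lambda>t. ennreal (t ^ q))) s
      = ennreal (1 / real q) * foldr pint u (\<lambda>t. ennreal (t ^ q)) s" if "0 < s" "s < 1" for s
    using foldr_pint_cong[of "pint 0 (\<lambda>t. ennreal (t ^ q))" "\<lambda>t. ennreal (1 / real q) * ennreal (t ^ q)" s u]
      that assms by (simp add: pint_zero_power foldr_pint_cmult)
  then have "wint p e (foldr pint u (pint 0 (\<lambda>t. ennreal (t ^ q))))
      = wint p e (\<lambda>s. ennreal (1 / real q) * foldr pint u (\<lambda>t. ennreal (t ^ q)) s)"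
    by (rule wint_cong)
  then show ?thesis by (simp add: Cons wint_cmult)
qed

text \<open>Linearity carries the splitting of \<open>pint_one_power\<close> through all outer
  integrals. Since \<open>v\<close> is non-empty, the final 1 is handled by \<open>pint\<close> and
  not by \<open>wint\<close>.\<close>

lemma ezeta_snoc_one:
  assumes "v \<noteq> []"
  shows "ezeta (v @ [1]) p q = ezeta (v @ [1]) p (Suc q) + ennreal (1 / real (Suc q)) * ezeta v p (Suc q)"
proof -
  obtain e u where v: "v = e # u" using assms by (cases v) auto
  let ?a = "pint 1 (\<lambda>t. ennreal (t ^ Suc q))" and ?b = "pint 0 (\<lambda>t. ennreal (t ^ Suc q))"
  have [measurable]: "?a \<in> borel_measurable borel" "?b \<in> borel_measurable borel" by measurable
  have "wint p e (foldr pint u (pint 1 (\<lambda>t. ennreal (t ^ q))))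
      = wint p e (foldr pint u (\<lambda>t. ?a t + ?b t))"
    by (intro wint_cong foldr_pint_cong pint_one_power) auto
  also have "\<dots> = wint p e (foldr pint u ?a) + wint p e (foldr pint u ?b)"
    by (subst foldr_pint_add, measurable) (subst wint_add, auto)
  finally have "ezeta (v @ [1]) p q = ezeta (v @ [1]) p (Suc q) + ezeta (v @ [0]) p (Suc q)"
    by (simp add: v)
  then show ?thesis by (simp only: ezeta_snoc_zero zero_less_Suc)
qed

text \<open>The factor 1/(1-t) lowers the weight to \<open>(1 - t) ^ (p - 1)\<close>. Integrating
  the outermost variable over s < t < 1 first gives \<open>(1 - s) ^ p / p\<close>, which is the
  weight of \<open>v\<close> up to the factor.\<close>

lemma ezeta_Cons_one:
  assumes "0 < p"
  shows "ezeta (1 # v) p q = ennreal (1 / real p) * ezeta v p q"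
proof -
  obtain a where a: "p = Suc a" using assms by (cases p) auto
  have *: "ezeta (1 # v) p q = (\<integral>\<^sup>+ t. ennreal ((1 - t) ^ a)
      * foldr pint v (\<lambda>t. ennreal (t ^ q)) t * indicator {0<..<1} t \<partial>lborel)"
    unfolding ezeta.simps wint_def
    by (intro nn_integral_cong)
       (auto simp: form_fun_def a split: split_indicator)
  show ?thesis
  proof (cases v)
    case Nil
    have "ezeta [1] p q = (\<integral>\<^sup>+ t. ennreal ((1 - t) ^ a * t ^ q) * indicator {0<..<1} t \<partial>lborel)"
      using * unfolding Nil
      by (auto simp: ennreal_mult intro!: nn_integral_cong split: split_indicator)
    then show ?thesis
      unfolding nn_integral_beta beta_choose(2) by (subst (asm) ennreal_mult) (auto simp: Nil a)
  next
    case (Cons e u)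
    define g where "g = foldr pint u (\<lambda>t. ennreal (t ^ q))"
    have [measurable]: "g \<in> borel_measurable borel" unfolding g_def by measurable
    \<comment> \<open>The domain 0 < s < t < 1 is put into the integrand, so that the order of
      integration can be exchanged on the whole plane.\<close>
    define H where "H t s = ennreal ((1 - t) ^ a) * (ennreal (form_fun e s) * g s) * 
      (if 0 < s \<and> s < t \<and> t < 1 then 1 else 0)" for t s
    have [measurable]: "case_prod H \<in> borel_measurable (lborel \<Otimes>\<^sub>M lborel)"
      unfolding H_def[abs_def] by measurable
    have "ezeta (1 # v) p q = (\<integral>\<^sup>+ t. (\<integral>\<^sup>+ s. H t s \<partial>lborel) \<partial>lborel)"
      unfolding * unfolding Cons foldr.simps comp_def g_def[symmetric] pint_def
    proof (intro nn_integral_cong)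
      fix t :: real
      have "ennreal ((1 - t) ^ a) * (\<integral>\<^sup>+ s. ennreal (form_fun e s) * g s * indicator {0<..<t} s \<partial>lborel)
          * indicator {0<..<1} t
        = (\<integral>\<^sup>+ s. (ennreal ((1 - t) ^ a) * indicator {0<..<1} t) * (ennreal (form_fun e s) * g s * indicator {0<..<t} s) \<partial>lborel)"
        by (subst nn_integral_cmult) (auto simp: mult_ac)
      also have "\<dots> = (\<integral>\<^sup>+ s. H t s \<partial>lborel)"
        by (intro nn_integral_cong) (auto simp: H_def indicator_def)
      finally show "ennreal ((1 - t) ^ a) * (\<integral>\<^sup>+ s. ennreal (form_fun e s) * g s * indicator {0<..<t} s \<partial>lborel)
          * indicator {0<..<1} t = (\<integral>\<^sup>+ s. H t s \<partial>lborel)" .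
    qed
    also have "\<dots> = (\<integral>\<^sup>+ s. (\<integral>\<^sup>+ t. H t s \<partial>lborel) \<partial>lborel)"
      by (rule lborel_pair.Fubini') measurable
    also have "\<dots> = (\<integral>\<^sup>+ s. ennreal (1 / real p) * (ennreal ((1 - s) ^ p * form_fun e s) * g s * indicator {0<..<1} s) \<partial>lborel)"
    proof (intro nn_integral_cong)
      fix s :: real
      show "(\<integral>\<^sup>+ t. H t s \<partial>lborel) = ennreal (1 / real p) * (ennreal ((1 - s) ^ p * form_fun e s) * g s * indicator {0<..<1} s)"
      proof (cases "0 < s \<and> s < 1")
        case True
        have "(\<integral>\<^sup>+ t. H t s \<partial>lborel) = (\<integral>\<^sup>+ t. (ennreal (form_fun e s) * g s) * (ennreal ((1 - t) ^ a) * indicator {s<..<1} t) \<partial>lborel)"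
          using True by (intro nn_integral_cong) (auto simp: H_def indicator_def mult_ac)
        also have "\<dots> = (ennreal (form_fun e s) * g s) * ennreal ((1 - s) ^ p / real p)"
          using True by (subst nn_integral_cmult) (auto simp: nn_integral_power_reflect a)
        also have "ennreal ((1 - s) ^ p / real p) = ennreal (1 / real p) * ennreal ((1 - s) ^ p)"
          using True by (subst ennreal_mult[symmetric]) auto
        finally show ?thesis using True form_fun_nonneg[of s e]
          by (simp add: ennreal_mult mult_ac)
      next
        case False
        then have "H t s = 0" for t by (auto simp: H_def)
        then show ?thesis using False by auto
      qed
    qed
    also have "\<dots> = ennreal (1 / real p) * wint p e g"
      unfolding wint_def by (rule nn_integral_cmult) measurable
    finally show ?thesis by (simp add: Cons g_def)
  qed
qed

text \<open>Dual to the recursion for a final 1: 1/t = (1-t)/t + 1, and the summand 1 becomes a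
  letter 1 with the raised left index.\<close>

lemma ezeta_Cons_zero:
  "ezeta (0 # v) p q = ezeta (0 # v) (Suc p) q + ennreal (1 / real (Suc p)) * ezeta v (Suc p) q"
proof -
  have *: "(1 - t) ^ p / t = (1 - t) ^ Suc p / t + (1 - t) ^ Suc p / (1 - t)"
    if "0 < t" "t < 1" for t :: real
    using that by (simp add: field_simps)
  have "ezeta (0 # v) p q = ezeta (0 # v) (Suc p) q + ezeta (1 # v) (Suc p) q"
    unfolding ezeta.simps wint_def using *
    by (subst nn_integral_add[symmetric])
       (auto simp: form_fun_def ennreal_plus[symmetric] ring_distribs[symmetric] simp del: ennreal_plus power_Suc
          intro!: nn_integral_cong split: split_indicator)
  then show ?thesis by (simp only: ezeta_Cons_one zero_less_Suc)
qed

section \<open>Finiteness and decay\<close>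

text \<open>
  With \<open>h(s) = \<surd>(s / (1 - s))\<close> one has \<open>2 h' = h / (s (1 - s))\<close>, which dominates both \<open>h / s\<close> and
  \<open>h / (1 - s)\<close>; so \<open>h\<close> is, up to a factor \<open>2\<close>, stable under \<open>pint\<close>, and \<open>h(t) / t\<close> is integrable.
\<close>

lemma pint_le_sqrt_quotient:
  assumes t: "0 < t" "t < 1"
    and le: "\<And>s. 0 < s \<Longrightarrow> s < 1 \<Longrightarrow>
      ennreal (form_fun e s) * g s \<le> ennreal (c * (sqrt s / sqrt (1 - s)) / (s * (1 - s)))"
    and c: "0 \<le> c"
  shows "pint e g t \<le> ennreal (2 * c * (sqrt t / sqrt (1 - t)))"
proof -
  define d where "d s = c * (sqrt s / sqrt (1 - s)) / (s * (1 - s))" for s :: real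
  have deriv: "((\<lambda>s. 2 * c * (sqrt s / sqrt (1 - s))) has_real_derivative d s) (at s)"
    if "0 < s" "s < t" for s
  proof -
    define x y where "x = sqrt s" and "y = sqrt (1 - s)"
    have x: "x > 0" "s = x\<^sup>2" and y: "y > 0" "1 - s = y\<^sup>2"
      using that t by (auto simp: x_def y_def)
    have xy: "x\<^sup>2 + y\<^sup>2 = 1" using x y by simp
    have dx: "(sqrt has_real_derivative inverse x / 2) (at s)"
      unfolding x_def using that by (intro DERIV_real_sqrt)
    have "(sqrt has_real_derivative inverse y / 2) (at (1 - s))"
      unfolding y_def using that t by (intro DERIV_real_sqrt) auto
    then have dy: "((\<lambda>s. sqrt (1 - s)) has_real_derivative inverse y / 2 * (- 1)) (at s)"
      by (rule DERIV_chain2) (auto intro!: derivative_eq_intros)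
    have "((\<lambda>s. 2 * c * (sqrt s / sqrt (1 - s))) has_real_derivative
        2 * c * ((inverse x / 2 * y - x * (inverse y / 2 * (- 1))) / (y * y))) (at s)"
      using y(1) DERIV_cmult[OF DERIV_divide[OF dx dy], of "2 * c"]
      unfolding y_def[symmetric] x_def[symmetric] by simp
    also have "2 * c * ((inverse x / 2 * y - x * (inverse y / 2 * (- 1))) / (y * y))
        = c * (x\<^sup>2 + y\<^sup>2) / (x * y ^ 3)"
      using x(1) y(1) by (simp add: field_simps power2_eq_square power3_eq_cube)
    also have "\<dots> = c * (x / y) / (x\<^sup>2 * y\<^sup>2)"
      unfolding xy using x(1) y(1) by (simp add: field_simps power2_eq_square power3_eq_cube)
    also have "\<dots> = d s"
      unfolding d_def x(2)[symmetric] y(2)[symmetric] unfolding x_def y_def ..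
    finally show ?thesis .
  qed
  have "pint e g t \<le> (\<integral>\<^sup>+ s. ennreal (d s) * indicator {0<..<t} s \<partial>lborel)"
    unfolding pint_def d_def using t le by (intro nn_integral_mono) (auto split: split_indicator)
  also have "\<dots> = ennreal (2 * c * (sqrt t / sqrt (1 - t)) - 2 * c * (sqrt 0 / sqrt (1 - 0)))"
  proof (rule nn_integral_FTC_Ioo)
    show "continuous_on {0..t} (\<lambda>s. 2 * c * (sqrt s / sqrt (1 - s)))"
      using t by (intro continuous_intros) auto
    show "d \<in> borel_measurable borel" unfolding d_def by measurable
    show "0 \<le> d s" if "0 < s" "s < t" for s using that t c by (simp add: d_def)
  qed (use t deriv in auto)
  finally show ?thesis by simp
qed

text \<open>The innermost letter 1 starts the estimate because sqrt(s(1-s)) is at most 1. Each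
  further letter is bounded by 1/(s(1-s)) and doubles the constant through
  \<open>pint_le_sqrt_quotient\<close>.\<close>

lemma foldr_pint_one_bound:
  assumes "0 < t" "t < 1"
  shows "foldr pint v (pint 1 (\<lambda>_. 1)) t \<le> ennreal (2 ^ Suc (length v) * (sqrt t / sqrt (1 - t)))"
  using assms
proof (induction v arbitrary: t)
  case Nil
  have "1 / (1 - s) \<le> sqrt s / sqrt (1 - s) / (s * (1 - s))" if "0 < s" "s < 1" for s :: real
  proof -
    define x y where "x = sqrt s" and "y = sqrt (1 - s)"
    have x: "x > 0" "s = x\<^sup>2" "x \<le> 1" and y: "y > 0" "1 - s = y\<^sup>2" "y \<le> 1"
      using that by (auto simp: x_def y_def)
    have "x * y \<le> 1" using x y by (simp add: mult_le_one)
    then have "1 / y\<^sup>2 \<le> x / y / (x\<^sup>2 * y\<^sup>2)"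
      using x(1) y(1) by (simp add: field_simps power2_eq_square)
    then show ?thesis
      unfolding x(2)[symmetric] y(2)[symmetric] unfolding x_def y_def .
  qed
  then show ?case
    using pint_le_sqrt_quotient[of t 1 "\<lambda>_. 1" 1] Nil
    by (auto simp: form_fun_def ennreal_leI)
next
  case (Cons e v)
  define c where "c = (2::real) ^ Suc (length v)"
  have c: "0 \<le> c" by (simp add: c_def)
  have "pint e (foldr pint v (pint 1 (\<lambda>_. 1))) t \<le> ennreal (2 * c * (sqrt t / sqrt (1 - t)))"
  proof (rule pint_le_sqrt_quotient)
    fix s :: real assume s: "0 < s" "s < 1"
    define h where "h = c * (sqrt s / sqrt (1 - s))"
    have h: "0 \<le> h" using s c by (simp add: h_def)
    have f: "form_fun e s \<le> 1 / (s * (1 - s))"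
      using s unfolding form_fun_def
      by (auto intro!: divide_left_mono mult_left_le_one_le mult_right_le_one_le)
    have "ennreal (form_fun e s) * foldr pint v (pint 1 (\<lambda>_. 1)) s
        \<le> ennreal (form_fun e s) * ennreal h"
      using Cons.IH[OF s] unfolding c_def h_def by (intro mult_left_mono) auto
    also have "\<dots> = ennreal (form_fun e s * h)"
      using h form_fun_nonneg[OF s] by (subst ennreal_mult) auto
    also have "\<dots> \<le> ennreal (h / (s * (1 - s)))"
      using mult_right_mono[OF f h] by (intro ennreal_leI) simp
    finally show "ennreal (form_fun e s) * foldr pint v (pint 1 (\<lambda>_. 1)) s
      \<le> ennreal (c * (sqrt s / sqrt (1 - s)) / (s * (1 - s)))" by (simp only: h_def)
  qed (use Cons.prems c in auto)
  then show ?case by (simp add: c_def)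
qed

text \<open>The outermost letter 0 leaves a multiple of 1/sqrt(t(1-t)). As sqrt t + sqrt(1-t) is at
  least 1, this is at most the same multiple of 1/sqrt t + 1/sqrt(1-t), which is integrable.\<close>

lemma ezeta_admissible_finite: "ezeta (0 # v @ [1]) 0 0 < top"
proof -
  define C where "C = (2::real) ^ Suc (length v)"
  have C: "C \<ge> 0" by (simp add: C_def)
  define d where "d t = C * (1 / sqrt t + 1 / sqrt (1 - t))" for t :: real
  have "ezeta (0 # v @ [1]) 0 0 \<le> (\<integral>\<^sup>+ t. ennreal (d t) * indicator {0<..<1} t \<partial>lborel)"
    unfolding ezeta.simps wint_def
  proof (intro nn_integral_mono)
    fix t :: real
    show "ennreal ((1 - t) ^ 0 * form_fun 0 t) * foldr pint (v @ [1]) (\<lambda>t. ennreal (t ^ 0)) t * indicator {0<..<1} t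
      \<le> ennreal (d t) * indicator {0<..<1} t"
    proof (cases "0 < t \<and> t < 1")
      case True
      then have "ennreal (1 / t) * foldr pint v (pint 1 (\<lambda>_. 1)) t
          \<le> ennreal (1 / t) * ennreal (C * (sqrt t / sqrt (1 - t)))"
        unfolding C_def by (intro mult_left_mono foldr_pint_one_bound) auto
      also have "\<dots> = ennreal (1 / t * (C * (sqrt t / sqrt (1 - t))))"
        using True C by (subst ennreal_mult) auto
      also have "\<dots> \<le> ennreal (d t)"
      proof (rule ennreal_leI)
        define x y where "x = sqrt t" and "y = sqrt (1 - t)"
        have x: "x > 0" "t = x\<^sup>2" and y: "y > 0" "1 - t = y\<^sup>2"
          using True by (auto simp: x_def y_def)
        have "1 \<le> x + y"
        proof (rule power2_le_imp_le)
          have "x\<^sup>2 + y\<^sup>2 = 1" using x(2) y(2) by simp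
          then show "1\<^sup>2 \<le> (x + y)\<^sup>2" using x(1) y(1) by (simp add: power2_sum)
        qed (use x y in auto)
        then have "1 / x\<^sup>2 * (x / y) \<le> 1 / x + 1 / y"
          using x(1) y(1) by (simp add: field_simps power2_eq_square)
        then have "C * (1 / x\<^sup>2 * (x / y)) \<le> C * (1 / x + 1 / y)"
          using C by (rule mult_left_mono)
        then show "1 / t * (C * (sqrt t / sqrt (1 - t))) \<le> d t"
          unfolding d_def x_def[symmetric] y_def[symmetric] unfolding x(2) by (simp add: mult_ac)
      qed
      finally show ?thesis using True by (simp add: form_fun_def)
    qed auto
  qed
  \<comment> \<open>The antiderivative of \<open>d\<close> is C (2 sqrt t - 2 sqrt(1-t)).\<close>
  also have "\<dots> = ennreal (C * (2 * sqrt 1 - 2 * sqrt (1 - 1)) - C * (2 * sqrt 0 - 2 * sqrt (1 - 0)))"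
    using C by (intro nn_integral_FTC_Ioo)
      (auto intro!: continuous_intros derivative_eq_intros simp: d_def field_simps)
  finally show ?thesis by (auto simp: less_top[symmetric] top_unique)
qed

text \<open>All inner variables lie below \<open>t\<close>, so the surplus power of the innermost
  one is at most \<open>t ^ M\<close>.\<close>

lemma foldr_pint_power_add:
  assumes "0 < t" "t < 1"
  shows "foldr pint v (\<lambda>t. ennreal (t ^ (n + M))) t
       \<le> ennreal (t ^ M) * foldr pint v (\<lambda>t. ennreal (t ^ n)) t"
  using assms
proof (induction v arbitrary: t)
  case Nil
  then show ?case by (simp add: ennreal_mult[symmetric] power_add mult_ac)
next
  case (Cons e v)
  have "foldr pint v (\<lambda>t. ennreal (t ^ (n + M))) s
      \<le> ennreal (t ^ M) * foldr pint v (\<lambda>t. ennreal (t ^ n)) s" if "0 < s" "s < t" for s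
  proof -
    have "foldr pint v (\<lambda>t. ennreal (t ^ (n + M))) s
        \<le> ennreal (s ^ M) * foldr pint v (\<lambda>t. ennreal (t ^ n)) s"
      using that Cons by auto
    also have "\<dots> \<le> ennreal (t ^ M) * foldr pint v (\<lambda>t. ennreal (t ^ n)) s"
      using that by (intro mult_right_mono ennreal_leI power_mono) auto
    finally show ?thesis .
  qed
  then have "pint e (foldr pint v (\<lambda>t. ennreal (t ^ (n + M)))) t
      \<le> pint e (\<lambda>s. ennreal (t ^ M) * foldr pint v (\<lambda>t. ennreal (t ^ n)) s) t"
    using Cons.prems by (intro pint_mono) auto
  then show ?case by (simp add: pint_cmult)
qed

text \<open>Raising both indices by \<open>M\<close> multiplies the integrand, after the inner
  estimate, by at most ((1-t)t)^M for the outermost variable \<open>t\<close>, and (1-t)t never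
  exceeds 1/4.\<close>

lemma ezeta_decay:
  assumes "x \<noteq> []"
  shows "ezeta x (m + M) (n + M) \<le> ennreal ((1/4) ^ M) * ezeta x m n"
proof -
  obtain e v where x: "x = e # v" using assms by (cases x) auto
  let ?J = "\<lambda>n. foldr pint v (\<lambda>t. ennreal (t ^ n))"
  have "ezeta x (m + M) (n + M) \<le> (\<integral>\<^sup>+ t. ennreal ((1/4) ^ M) *
      (ennreal ((1 - t) ^ m * form_fun e t) * ?J n t * indicator {0<..<1} t) \<partial>lborel)"
    unfolding x ezeta.simps wint_def
  proof (intro nn_integral_mono)
    fix t :: real
    show "ennreal ((1 - t) ^ (m + M) * form_fun e t) * ?J (n + M) t * indicator {0<..<1} t
      \<le> ennreal ((1/4) ^ M) * (ennreal ((1 - t) ^ m * form_fun e t) * ?J n t * indicator {0<..<1} t)"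
    proof (cases "0 < t \<and> t < 1")
      case True
      define f where "f = (1 - t) ^ m * form_fun e t"
      have f: "0 \<le> f" using True form_fun_nonneg[of t e] by (simp add: f_def)
      have "(1 - t) * t \<le> 1 / 4"
        using zero_le_power2[of "t - 1/2"] by (simp add: power2_eq_square algebra_simps)
      then have 4: "((1 - t) * t) ^ M \<le> (1/4) ^ M" using True by (intro power_mono) auto
      have "ennreal ((1 - t) ^ (m + M) * form_fun e t) * ?J (n + M) t
          \<le> ennreal ((1 - t) ^ (m + M) * form_fun e t) * (ennreal (t ^ M) * ?J n t)"
        using True by (intro mult_left_mono foldr_pint_power_add) auto
      also have "\<dots> = ennreal ((1 - t) ^ (m + M) * form_fun e t * t ^ M) * ?J n t"
        using True form_fun_nonneg[of t e] by (simp add: ennreal_mult mult.assoc)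
      also have "(1 - t) ^ (m + M) * form_fun e t * t ^ M = ((1 - t) * t) ^ M * f"
        by (simp add: f_def power_add power_mult_distrib mult_ac)
      also have "ennreal (((1 - t) * t) ^ M * f) * ?J n t \<le> ennreal ((1/4) ^ M * f) * ?J n t"
        using 4 f by (intro mult_right_mono ennreal_leI) auto
      also have "\<dots> = ennreal ((1/4) ^ M) * (ennreal f * ?J n t)"
        using f by (simp add: ennreal_mult mult_ac)
      finally show ?thesis using True by (simp add: f_def)
    qed auto
  qed
  also have "\<dots> = ennreal ((1/4) ^ M) * ezeta x m n"
    unfolding x ezeta.simps wint_def by (rule nn_integral_cmult) measurable
  finally show ?thesis .
qed

lemma ezeta_le:
  assumes "x \<noteq> []"
  shows "ezeta x m n \<le> ezeta x 0 0"
proof -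
  obtain e v where x: "x = e # v" using assms by (cases x) auto
  have "(1 - t) ^ m * form_fun e t \<le> form_fun e t" if "0 < t" "t < 1" for t
    using that form_fun_nonneg[OF that, of e]
    by (intro mult_left_le_one_le power_le_one) auto
  then show ?thesis
    unfolding x ezeta.simps wint_def
    by (intro nn_integral_mono)
       (auto split: split_indicator intro!: mult_mono ennreal_leI foldr_pint_mono power_le_one)
qed

lemma bit_cases: "(e::bit) = 0 \<or> e = 1"
  by (cases e) auto

text \<open>Leading 1s and trailing 0s can be stripped, since the index they divide by is then
  positive. What remains is empty or admissible, and \<open>ezeta_le\<close> reduces it to indices
  0.\<close>

lemma ezeta_finite:
  assumes "0 < m \<or> x = [] \<or> hd x = 0" "0 < n \<or> x = [] \<or> last x = 1"
  shows "ezeta x m n < top"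
  using assms
proof (induction x rule: length_induct)
  case (1 x)
  show ?case
  proof (cases "x = []")
    case True
    then show ?thesis by simp
  next
    case False
    show ?thesis
    proof (cases "hd x = 1")
      case True
      then obtain v where x: "x = 1 # v" using False by (cases x) auto
      have m: "0 < m" using True 1 False by auto
      have "ezeta v m n < top"
        using "1.IH" "1.prems" m x by (auto split: if_splits)
      then show ?thesis unfolding x ezeta_Cons_one[OF m] by (simp add: ennreal_mult_less_top)
    next
      case h: False
      then have h: "hd x = 0" using bit_cases by blast
      show ?thesis
      proof (cases "last x = 0")
        case True
        then obtain v where x: "x = v @ [0]" using False by (cases x rule: rev_cases) auto
        have n: "0 < n" using True 1 False by auto
        have "ezeta v m n < top"
          using "1.IH" "1.prems" n x h by (auto simp: hd_append split: if_splits)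
        then show ?thesis unfolding x ezeta_snoc_zero[OF n] by (simp add: ennreal_mult_less_top)
      next
        case l: False
        then have l: "last x = 1" using bit_cases by blast
        then obtain v where x: "x = 0 # v @ [1]" using False h
          by (cases x; cases "tl x" rule: rev_cases) auto
        have "ezeta x m n \<le> ezeta x 0 0" using False by (rule ezeta_le)
        also have "\<dots> < top" unfolding x by (rule ezeta_admissible_finite)
        finally show ?thesis .
      qed
    qed
  qed
qed

section \<open>The integral over the simplex\<close>

lemma measurable_coordinate:
  "i \<in> I \<Longrightarrow> (\<lambda>t. t i) \<in> borel_measurable (\<Pi>\<^sub>M i\<in>I. (lborel :: real measure))"
  using measurable_component_singleton[of i I "\<lambda>_. lborel :: real measure"] by simp

lemma sets_open_simplex: "open_simplex k \<in> sets (\<Pi>\<^sub>M i\<in>{1..k}. lborel)"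
proof -
  let ?M = "\<Pi>\<^sub>M i\<in>{1..k}. (lborel :: real measure)"
  note [measurable] = measurable_coordinate
  have "{t \<in> space ?M. \<forall>i\<in>{1..k}. 0 < t i \<and> t i < 1} \<in> sets ?M"
    by (intro sets.sets_Collect_finite_All) auto
  moreover have "{t \<in> space ?M. \<forall>i\<in>{1..<k}. t (i + 1) < t i} \<in> sets ?M"
    by (intro sets.sets_Collect_finite_All) auto
  moreover have "open_simplex k = {t \<in> space ?M. \<forall>i\<in>{1..k}. 0 < t i \<and> t i < 1}
      \<inter> {t \<in> space ?M. \<forall>i\<in>{1..<k}. t (i + 1) < t i}"
    by (auto simp: open_simplex_def space_PiM)
  ultimately show ?thesis by (simp add: sets.Int)
qed

lemma measurable_simplex_integrand:
  fixes k :: nat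
  assumes "0 < k"
  shows "(\<lambda>t. (1 - t 1) ^ m * (\<Prod>i=1..k. form_fun (f i) (t i)))
    \<in> borel_measurable (\<Pi>\<^sub>M i\<in>{1..k}. (lborel :: real measure))"
proof -
  have "(1::nat) \<in> {1..k}" using assms by auto
  then show ?thesis
    by (intro borel_measurable_times borel_measurable_power borel_measurable_diff
        borel_measurable_const borel_measurable_prod measurable_compose[OF _ measurable_form_fun]
        measurable_coordinate) auto
qed

lemma open_simplex_Suc_iff:
  assumes "0 < k" "t \<in> space (\<Pi>\<^sub>M i\<in>{1..k}. (lborel :: real measure))"
  shows "t(Suc k := y) \<in> open_simplex (Suc k) \<longleftrightarrow> t \<in> open_simplex k \<and> 0 < y \<and> y < t k"
proof
  have ext: "t \<in> {1..k} \<rightarrow>\<^sub>E UNIV" using assms by (simp add: space_PiM)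
  {
    assume *: "t(Suc k := y) \<in> open_simplex (Suc k)"
    let ?u = "t(Suc k := y)"
    have pos: "\<forall>i\<in>{1..Suc k}. 0 < ?u i \<and> ?u i < 1" and dec: "\<forall>i\<in>{1..<Suc k}. ?u (i + 1) < ?u i"
      using * unfolding open_simplex_def by blast+
    have "0 < t i \<and> t i < 1" if "i \<in> {1..k}" for i
      using bspec[OF pos, of i] that by auto
    moreover have "t (i + 1) < t i" if "i \<in> {1..<k}" for i
      using bspec[OF dec, of i] that by auto
    moreover have "0 < y" "y < t k"
      using bspec[OF pos, of "Suc k"] bspec[OF dec, of k] assms(1) by auto
    ultimately show "t \<in> open_simplex k \<and> 0 < y \<and> y < t k"
      using ext by (simp add: open_simplex_def)
  }
  {
    assume *: "t \<in> open_simplex k \<and> 0 < y \<and> y < t k"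
    then have "t k < 1" using assms by (auto simp: open_simplex_def)
    with * ext show "t(Suc k := y) \<in> open_simplex (Suc k)"
      by (auto simp: open_simplex_def less_Suc_eq le_Suc_eq PiE_iff extensional_def)
  }
qed

text \<open>Induction from the right end: the last coordinate is innermost, and integrating it
  replaces \<open>g\<close> by \<open>pint e g\<close>. This is why the statement is proved for
  arbitrary \<open>g\<close>.\<close>

lemma simplex_integral_eq_wint:
  assumes "w \<noteq> []" "g \<in> borel_measurable borel"
  shows "(\<integral>\<^sup>+ t. ennreal ((1 - t 1) ^ m * (\<Prod>i=1..length w. form_fun (w ! (i - 1)) (t i)))
            * g (t (length w)) * indicator (open_simplex (length w)) t
            \<partial>(\<Pi>\<^sub>M i\<in>{1..length w}. lborel))
       = wint m (hd w) (foldr pint (tl w) g)"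
  using assms
proof (induction w arbitrary: g rule: rev_induct)
  case Nil
  then show ?case by simp
next
  case (snoc e w)
  interpret product_sigma_finite "\<lambda>_::nat. lborel :: real measure" ..
  note [measurable] = snoc.prems(2)
  show ?case
  proof (cases "w = []")
    case True
    let ?f = "\<lambda>t. ennreal ((1 - t) ^ m * form_fun e t) * g t * indicator {0<..<1} t"
    have "(\<integral>\<^sup>+ t. ennreal ((1 - t 1) ^ m * (\<Prod>i=1..1. form_fun ([e] ! (i - 1)) (t i)))
            * g (t 1) * indicator (open_simplex 1) t \<partial>(\<Pi>\<^sub>M i\<in>{1}. lborel))
        = (\<integral>\<^sup>+ t. ?f (t 1) \<partial>(\<Pi>\<^sub>M i\<in>{1::nat}. lborel))"
      by (intro nn_integral_cong)
         (auto simp: open_simplex_def space_PiM split: split_indicator)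
    also have "\<dots> = (\<integral>\<^sup>+ t. ?f t \<partial>lborel)"
      by (intro product_nn_integral_singleton) measurable
    finally show ?thesis using True by (simp add: wint_def)
  next
    case False
    define k where "k = length w"
    have k: "0 < k" using False by (simp add: k_def)
    let ?M = "\<lambda>k::nat. \<Pi>\<^sub>M i\<in>{1..k}. (lborel :: real measure)"
    let ?c = "\<lambda>t. (1 - t 1) ^ m * (\<Prod>i=1..k. form_fun (w ! (i - 1)) (t i))"
    let ?F = "\<lambda>t. ennreal ((1 - t 1) ^ m * (\<Prod>i=1..Suc k. form_fun ((w @ [e]) ! (i - 1)) (t i)))
            * g (t (Suc k)) * indicator (open_simplex (Suc k)) t"
    have ins: "{1..Suc k} = insert (Suc k) {1..k}" by auto
    have "?F \<in> borel_measurable (?M (Suc k))"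
      by (intro borel_measurable_times_ennreal measurable_compose[OF measurable_simplex_integrand measurable_ennreal]
           borel_measurable_indicator sets_open_simplex
           measurable_compose[OF measurable_coordinate snoc.prems(2)]) auto
    then have "(\<integral>\<^sup>+ t. ?F t \<partial>?M (Suc k)) = (\<integral>\<^sup>+ t. (\<integral>\<^sup>+ y. ?F (t(Suc k := y)) \<partial>lborel) \<partial>?M k)"
      unfolding ins by (intro product_nn_integral_insert) auto
    also have "\<dots> = (\<integral>\<^sup>+ t. ennreal (?c t) * pint e g (t k) * indicator (open_simplex k) t \<partial>?M k)"
    proof (intro nn_integral_cong)
      fix t assume t: "t \<in> space (?M k)"
      have "(\<integral>\<^sup>+ y. ?F (t(Suc k := y)) \<partial>lborel)
          = (\<integral>\<^sup>+ y. (ennreal (?c t) * indicator (open_simplex k) t)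
               * (ennreal (form_fun e y) * g y * indicator {0<..<t k} y) \<partial>lborel)"
      proof (intro nn_integral_cong)
        fix y :: real
        show "?F (t(Suc k := y)) = (ennreal (?c t) * indicator (open_simplex k) t)
               * (ennreal (form_fun e y) * g y * indicator {0<..<t k} y)"
        proof (cases "t \<in> open_simplex k \<and> 0 < y \<and> y < t k")
          case True
          have t01: "0 < t i \<and> t i < 1" if "i \<in> {1..k}" for i
            using True that by (auto simp: open_simplex_def)
          have "0 \<le> ?c t" using t01 k
            by (intro mult_nonneg_nonneg prod_nonneg zero_le_power) (auto intro!: form_fun_nonneg simp: less_imp_le)
          moreover have "0 \<le> form_fun e y"
            using True t01[of k] k by (intro form_fun_nonneg) auto
          moreover have "(\<Prod>i=1..k. form_fun ((w @ [e]) ! (i - 1)) ((t(Suc k := y)) i))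
              = (\<Prod>i=1..k. form_fun (w ! (i - 1)) (t i))"
            by (intro prod.cong) (auto simp: nth_append k_def)
          then have "((1 - (t(Suc k := y)) 1) ^ m * (\<Prod>i=1..Suc k. form_fun ((w @ [e]) ! (i - 1)) ((t(Suc k := y)) i)))
              = ?c t * form_fun e y"
            using k by (simp add: k_def)
          ultimately show ?thesis
            using True open_simplex_Suc_iff[OF k t, of y] by (simp add: ennreal_mult mult_ac)
        next
          case False
          then show ?thesis
            using open_simplex_Suc_iff[OF k t, of y] by (auto simp: indicator_def)
        qed
      qed
      also have "\<dots> = ennreal (?c t) * indicator (open_simplex k) t * pint e g (t k)"
        unfolding pint_def by (rule nn_integral_cmult) measurable
      finally show "(\<integral>\<^sup>+ y. ?F (t(Suc k := y)) \<partial>lborel)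
          = ennreal (?c t) * pint e g (t k) * indicator (open_simplex k) t"
        by (simp add: mult_ac)
    qed
    also have "\<dots> = wint m (hd w) (foldr pint (tl w) (pint e g))"
      unfolding k_def using False by (intro snoc.IH measurable_pint) auto
    finally show ?thesis using False by (simp add: k_def)
  qed
qed

text \<open>The integrand is non-negative on the simplex, so its Lebesgue integral is the real value
  of the \<open>ennreal\<close> integral. Convergence need not be known here, as both sides are 0 in
  the divergent case.\<close>

lemma zeta_mn_eq_ezeta:
  assumes "w \<noteq> []"
  shows "zeta_mn w m n = enn2real (ezeta w m n)"
proof -
  define k where "k = length w"
  have k: "0 < k" using assms by (simp add: k_def)
  let ?M = "\<Pi>\<^sub>M i\<in>{1..k}. (lborel :: real measure)"
  let ?c = "\<lambda>t. (1 - t 1) ^ m * (\<Prod>i=1..k. form_fun (w ! (i - 1)) (t i))"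
  have nn: "0 \<le> ?c t" "0 \<le> t k" if "t \<in> open_simplex k" for t
  proof -
    have t01: "0 < t i \<and> t i < 1" if "i \<in> {1..k}" for i
      using \<open>t \<in> open_simplex k\<close> that by (auto simp: open_simplex_def)
    show "0 \<le> ?c t" using t01 k
      by (intro mult_nonneg_nonneg prod_nonneg zero_le_power) (auto intro!: form_fun_nonneg simp: less_imp_le)
    show "0 \<le> t k" using t01[of k] k by simp
  qed
  have "zeta_mn w m n = (LINT t|?M. indicator (open_simplex k) t *\<^sub>R (?c t * t k ^ n))"
    by (simp add: zeta_mn_def Let_def set_lebesgue_integral_def k_def)
  also have "\<dots> = enn2real (\<integral>\<^sup>+ t. ennreal (indicator (open_simplex k) t *\<^sub>R (?c t * t k ^ n)) \<partial>?M)"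
  proof (rule integral_eq_nn_integral)
    show "(\<lambda>t. indicator (open_simplex k) t *\<^sub>R (?c t * t k ^ n)) \<in> borel_measurable ?M"
      using k by (intro borel_measurable_scaleR borel_measurable_indicator sets_open_simplex
        borel_measurable_times borel_measurable_power measurable_simplex_integrand measurable_coordinate) auto
    show "AE t in ?M. 0 \<le> indicator (open_simplex k) t *\<^sub>R (?c t * t k ^ n)"
      using nn by (intro AE_I2) (auto split: split_indicator)
  qed
  also have "(\<integral>\<^sup>+ t. ennreal (indicator (open_simplex k) t *\<^sub>R (?c t * t k ^ n)) \<partial>?M)
      = (\<integral>\<^sup>+ t. ennreal (?c t) * ennreal (t k ^ n) * indicator (open_simplex k) t \<partial>?M)"
    using nn by (intro nn_integral_cong) (auto simp: ennreal_mult split: split_indicator)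
  also have "\<dots> = wint m (hd w) (foldr pint (tl w) (\<lambda>t. ennreal (t ^ n)))"
    unfolding k_def using assms by (intro simplex_integral_eq_wint) auto
  also have "\<dots> = ezeta w m n" using assms by (cases w) auto
  finally show ?thesis .
qed

section \<open>Peeling a word from both ends\<close>

definition dual_word :: "bit list \<Rightarrow> bit list" where
  "dual_word u = map bit_compl (rev u)"

text \<open>\<open>i\<close> and \<open>j\<close> are cuts between letters, so the factor consists
  of the letters numbered \<open>i + 1\<close> to \<open>j\<close>.\<close>

definition subword :: "bit list \<Rightarrow> nat \<Rightarrow> nat \<Rightarrow> bit list" where
  "subword w i j = drop i (take j w)"

definition rzeta :: "bit list \<Rightarrow> nat \<Rightarrow> nat \<Rightarrow> real" where
  "rzeta x p q = enn2real (ezeta x p q)"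

text \<open>The index set runs over the factors with first letter 0 and last letter 1, that is, over
  the non-empty admissible ones, each given by its two cuts.\<close>

definition remainder :: "bit list \<Rightarrow> nat \<Rightarrow> nat \<Rightarrow> nat \<Rightarrow> real" where
  "remainder w m n M =
     (\<Sum>i | i < length w \<and> w ! i = 0. \<Sum>j | i < j \<and> j \<le> length w \<and> w ! (j - 1) = 1.
        tail_sum m (dual_word (take i w)) (m + M) * tail_sum n (drop j w) (n + M)
          * rzeta (subword w i j) (m + M) (n + M))"

section \<open>Real-valued recursions and bookkeeping for factors\<close>

lemma rzeta_nonneg: "0 \<le> rzeta x p q"
  by (simp add: rzeta_def)

lemma rzeta_Nil: "rzeta [] p q = 1 / real ((p + q) choose p)"
  by (simp add: rzeta_def)

lemma rzeta_snoc_zero: "0 < q \<Longrightarrow> rzeta (v @ [0]) p q = rzeta v p q / real q"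
  by (simp add: rzeta_def ezeta_snoc_zero enn2real_mult)

lemma rzeta_Cons_one: "0 < p \<Longrightarrow> rzeta (1 # v) p q = rzeta v p q / real p"
  by (simp add: rzeta_def ezeta_Cons_one enn2real_mult del: ezeta.simps)

text \<open>\<open>enn2real\<close> is additive only on finite values. The first letter 0 secures
  finiteness on the left even for \<open>p = 0\<close>; on the right the raised index is
  positive.\<close>

lemma rzeta_snoc_one:
  assumes "v \<noteq> []" "hd v = 0"
  shows "rzeta (v @ [1]) p q = rzeta (v @ [1]) p (Suc q) + rzeta v p (Suc q) / real (Suc q)"
proof -
  have "ezeta (v @ [1]) p (Suc q) < top" "ezeta v p (Suc q) < top"
    using assms by (auto intro!: ezeta_finite)
  then show ?thesis
    unfolding rzeta_def ezeta_snoc_one[OF assms(1), of p q]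
    by (subst enn2real_plus) (auto simp: enn2real_mult ennreal_mult_less_top)
qed

lemma rzeta_Cons_zero:
  assumes "0 < q"
  shows "rzeta (0 # v) p q = rzeta (0 # v) (Suc p) q + rzeta v (Suc p) q / real (Suc p)"
proof -
  have "ezeta (0 # v) (Suc p) q < top" "ezeta v (Suc p) q < top"
    using assms by (auto intro!: ezeta_finite simp del: ezeta.simps)
  then show ?thesis
    unfolding rzeta_def ezeta_Cons_zero[of v p q]
    by (subst enn2real_plus) (auto simp: enn2real_mult ennreal_mult_less_top simp del: ezeta.simps)
qed

lemma subword_snoc: "i < j \<Longrightarrow> j \<le> length w \<Longrightarrow> subword w i j = subword w i (j - 1) @ [w ! (j - 1)]"
  by (cases j) (auto simp: subword_def take_Suc_conv_app_nth)

lemma subword_Cons: "i < j \<Longrightarrow> j \<le> length w \<Longrightarrow> subword w i j = w ! i # subword w (Suc i) j"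
  by (simp add: subword_def Cons_nth_drop_Suc[symmetric])

lemma subword_self: "subword w i i = []"
  by (simp add: subword_def)

lemma dual_word_take_Suc:
  "i < length w \<Longrightarrow> dual_word (take (Suc i) w) = bit_compl (w ! i) # dual_word (take i w)"
  by (simp add: dual_word_def take_Suc_conv_app_nth)

lemma not_zero_bit: "(e::bit) \<noteq> 0 \<longleftrightarrow> e = 1"
  using bit_cases[of e] by auto

text \<open>Collects the empty-word contributions of one round. With \<pi>(i) = \<sigma>(i)
  \<rho>(i), a letter 0 between the cuts i and i+1 yields (1 + P/Q) \<pi>(i+1), and a letter 1
  yields \<pi>(i+1) + (Q/P) \<pi>(i). Sorting by cuts gives each inner cut the factor
  \<open>lam\<close>; the outer cuts vanish.\<close>

lemma sum_products_eq_lam: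
  fixes \<sigma> \<rho> T U :: "nat \<Rightarrow> real" and w :: "bit list"
  assumes P: "0 < P" and Q: "0 < Q" and \<sigma>0: "\<sigma> 0 = 0" and \<rho>k: "\<rho> (length w) = 0" and "w \<noteq> []"
    and A: "\<And>i. i < length w \<Longrightarrow> w ! i = 0 \<Longrightarrow> \<sigma> (Suc i) = U i / real P \<and> \<rho> i = \<rho> (Suc i) / real Q"
    and B: "\<And>i. i < length w \<Longrightarrow> w ! i = 1 \<Longrightarrow> \<rho> i = T (Suc i) / real Q \<and> \<sigma> (Suc i) = \<sigma> i / real P"
  shows "(\<Sum>j | 0 < j \<and> j \<le> length w \<and> w ! (j - 1) = 1. (T j + \<rho> j) * \<sigma> j)
       + (\<Sum>i | i < length w \<and> w ! i = 0. U i * \<rho> i) * (real (P + Q) / real P)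
       = (\<Sum>i=1..length w - 1. \<sigma> i * \<rho> i * lam P Q (w ! (i - 1)) (w ! i))"
proof -
  define k where "k = length w"
  have k: "0 < k" using assms by (simp add: k_def)
  let ?\<pi> = "\<lambda>i. \<sigma> i * \<rho> i"
  let ?a = "\<lambda>i. if w ! i = 0 then real P / real Q else 0"
  let ?b = "\<lambda>i. if w ! i = 1 then real Q / real P else 0"
  have "(\<Sum>j | 0 < j \<and> j \<le> k \<and> w ! (j - 1) = 1. (T j + \<rho> j) * \<sigma> j)
      = (\<Sum>i | i < k \<and> w ! i = 1. (T (Suc i) + \<rho> (Suc i)) * \<sigma> (Suc i))"
    by (rule sum.reindex_bij_witness[of _ Suc "\<lambda>j. j - 1"]) auto
  also have "{i. i < k \<and> w ! i = 1} = {i\<in>{..<k}. w ! i = 1}" by auto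
  also have "(\<Sum>i\<in>{i\<in>{..<k}. w ! i = 1}. (T (Suc i) + \<rho> (Suc i)) * \<sigma> (Suc i))
      = (\<Sum>i<k. if w ! i = 1 then (T (Suc i) + \<rho> (Suc i)) * \<sigma> (Suc i) else 0)"
    by (rule sum.inter_filter) simp
  finally have 1: "(\<Sum>j | 0 < j \<and> j \<le> k \<and> w ! (j - 1) = 1. (T j + \<rho> j) * \<sigma> j) = \<dots>" .
  have set: "{i. i < k \<and> w ! i = 0} = {i\<in>{..<k}. w ! i = 0}" by auto
  have 2: "(\<Sum>i | i < k \<and> w ! i = 0. U i * \<rho> i)
      = (\<Sum>i<k. if w ! i = 0 then U i * \<rho> i else 0)"
    unfolding set by (rule sum.inter_filter) simp
  have "(\<Sum>i<k. if w ! i = 1 then (T (Suc i) + \<rho> (Suc i)) * \<sigma> (Suc i) else 0)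
      + (\<Sum>i<k. if w ! i = 0 then U i * \<rho> i else 0) * (real (P + Q) / real P)
      = (\<Sum>i<k. ?\<pi> (Suc i) * (1 + ?a i) + ?\<pi> i * ?b i)"
    unfolding sum_distrib_right sum.distrib[symmetric]
  proof (intro sum.cong refl)
    fix i assume "i \<in> {..<k}"
    then have i: "i < length w" by (simp add: k_def)
    show "(if w ! i = 1 then (T (Suc i) + \<rho> (Suc i)) * \<sigma> (Suc i) else 0)
      + (if w ! i = 0 then U i * \<rho> i else 0) * (real (P + Q) / real P)
      = ?\<pi> (Suc i) * (1 + ?a i) + ?\<pi> i * ?b i"
    proof (cases "w ! i = 0")
      case True
      then have "U i = real P * \<sigma> (Suc i)" "\<rho> (Suc i) = real Q * \<rho> i"
        using A[OF i] P Q by auto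
      with True P Q show ?thesis by (simp add: field_simps)
    next
      case False
      then have "w ! i = 1" by (simp only: not_zero_bit)
      moreover from this have "T (Suc i) = real Q * \<rho> i" "\<sigma> i = real P * \<sigma> (Suc i)"
        using B[OF i] P Q by auto
      ultimately show ?thesis using P Q by (simp add: field_simps)
    qed
  qed
  also have "\<dots> = (\<Sum>i<k. ?\<pi> (Suc i) * (1 + ?a i)) + (\<Sum>i<k. ?\<pi> i * ?b i)"
    by (rule sum.distrib)
  also have "(\<Sum>i<k. ?\<pi> (Suc i) * (1 + ?a i)) = (\<Sum>i\<in>{1..k}. ?\<pi> i * (1 + ?a (i - 1)))"
    by (rule sum.reindex_bij_witness[of _ "\<lambda>j. j - 1" Suc]) auto
  also have "\<dots> = (\<Sum>i\<in>{1..k - 1}. ?\<pi> i * (1 + ?a (i - 1)))"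
    using k \<rho>k by (intro sum.mono_neutral_right) (auto simp: k_def[symmetric] not_le dest!: le_antisym)
  also have "(\<Sum>i<k. ?\<pi> i * ?b i) = (\<Sum>i\<in>{1..k - 1}. ?\<pi> i * ?b i)"
  proof (intro sum.mono_neutral_right ballI)
    fix i assume "i \<in> {..<k} - {1..k - 1}"
    then have "i = 0" by auto
    then show "?\<pi> i * ?b i = 0" by (simp add: \<sigma>0)
  qed (use k in auto)
  also have "(\<Sum>i\<in>{1..k - 1}. ?\<pi> i * (1 + ?a (i - 1))) + (\<Sum>i\<in>{1..k - 1}. ?\<pi> i * ?b i)
      = (\<Sum>i=1..k - 1. \<sigma> i * \<rho> i * lam P Q (w ! (i - 1)) (w ! i))"
    unfolding sum.distrib[symmetric] by (intro sum.cong) (auto simp: lam_def algebra_simps)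
  finally show ?thesis using 1 2 by (simp only: k_def)
qed

text \<open>First the right index is raised for each fixed left end, then the left index for each
  fixed right end. The factors that become empty on the way form one term of the series.\<close>

lemma remainder_step:
  assumes "w \<noteq> []"
  shows "remainder w m n M = remainder w m n (Suc M)
    + 1 / real ((m + n + 2 * Suc M) choose (m + Suc M)) *
      (\<Sum>i=1..length w - 1. phi_word m (dual_word (take i w)) (m + Suc M) * phi_word n (drop i w) (n + Suc M) *
         lam (m + Suc M) (n + Suc M) (w ! (i - 1)) (w ! i))"
proof -
  define k where "k = length w"
  define p q where "p = m + M" and "q = n + M"
  define P Q where "P = Suc p" and "Q = Suc q"
  define U where "U i = tail_sum m (dual_word (take i w)) p" for i
  define \<sigma> where "\<sigma> i = phi_word m (dual_word (take i w)) P" for i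
  define T where "T j = tail_sum n (drop j w) q" for j
  define \<rho> where "\<rho> j = phi_word n (drop j w) Q" for j
  define z where "z i j = rzeta (subword w i j)" for i j
  have U': "tail_sum m (dual_word (take i w)) P = U i + \<sigma> i" for i
    by (simp add: U_def \<sigma>_def P_def tail_sum_Suc p_def)
  have T': "tail_sum n (drop j w) Q = T j + \<rho> j" for j
    by (simp add: T_def \<rho>_def Q_def tail_sum_Suc q_def)
  have \<sigma>0: "\<sigma> 0 = 0" by (simp add: \<sigma>_def dual_word_def)
  have \<rho>k: "\<rho> k = 0" by (simp add: \<rho>_def k_def)
  have A: "\<sigma> (Suc i) = U i / real P \<and> \<rho> i = \<rho> (Suc i) / real Q" if "i < k" "w ! i = 0" for i
    using that Cons_nth_drop_Suc[of i w, symmetric]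
    by (simp add: \<sigma>_def \<rho>_def U_def P_def k_def dual_word_take_Suc bit_compl_def phi_word_one del: phi_word.simps(2) of_nat_Suc)
       (simp add: phi_word_zero)
  have B: "\<rho> i = T (Suc i) / real Q \<and> \<sigma> (Suc i) = \<sigma> i / real P" if "i < k" "w ! i = 1" for i
    using that Cons_nth_drop_Suc[of i w, symmetric]
    by (simp add: \<sigma>_def \<rho>_def T_def Q_def k_def dual_word_take_Suc bit_compl_def phi_word_one del: phi_word.simps(2) of_nat_Suc)
       (simp add: phi_word_zero)
  have right: "(\<Sum>j | i < j \<and> j \<le> k \<and> w ! (j - 1) = 1. T j * z i j p q)
       = (\<Sum>j | i < j \<and> j \<le> k \<and> w ! (j - 1) = 1. (T j + \<rho> j) * z i j p Q) + \<rho> i * z i i p Q"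
    if i: "i < k" "w ! i = 0" for i
  proof (rule right_peeling_sum[where q = "real Q"])
    fix j assume j: "i < j" "j \<le> k" "w ! (j - 1) = 1"
    \<comment> \<open>A letter cannot be both 0 and 1, so the factor has at least two letters and is
      still non-empty without its final 1, as \<open>rzeta_snoc_one\<close> requires.\<close>
    have "i < j - 1"
      using i j by (cases "i = j - 1") auto
    then have "subword w i (j - 1) = w ! i # subword w (Suc i) (j - 1)"
      using j by (intro subword_Cons) (auto simp: k_def)
    then show "z i j p q = z i j p Q + z i (j - 1) p Q / real Q \<and> \<rho> (j - 1) = T j / real Q"
      using B[of "j - 1"] j i rzeta_snoc_one[of "subword w i (j - 1)" p q]
      by (simp add: z_def subword_snoc[of i j] k_def Q_def)
  next
    fix j assume j: "i < j" "j \<le> k" "w ! (j - 1) \<noteq> 1"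
    then have "w ! (j - 1) = 0" using bit_cases by blast
    then show "z i j p Q = z i (j - 1) p Q / real Q \<and> \<rho> (j - 1) = \<rho> j / real Q"
      using A[of "j - 1"] j rzeta_snoc_zero[of Q "subword w i (j - 1)" p]
      by (simp add: z_def subword_snoc[of i j] k_def Q_def)
  qed (use i \<rho>k in auto)
  have left: "(\<Sum>i | i < j \<and> w ! i = 0. U i * z i j p Q)
       = (\<Sum>i | i < j \<and> w ! i = 0. (U i + \<sigma> i) * z i j P Q) + \<sigma> j * z j j P Q"
    if j: "j \<le> k" for j
  proof (rule left_peeling_sum[where p = "real P"])
    fix i assume i: "i < j" "w ! i = 0"
    then show "z i j p Q = z i j P Q + z (Suc i) j P Q / real P \<and> \<sigma> (Suc i) = U i / real P"
      using A[of i] j rzeta_Cons_zero[of Q "subword w (Suc i) j" p]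
      by (simp add: z_def subword_Cons[of i j] k_def P_def Q_def)
  next
    fix i assume i: "i < j" "w ! i \<noteq> 0"
    then have "w ! i = 1" by (simp only: not_zero_bit)
    then show "z i j P Q = z (Suc i) j P Q / real P \<and> \<sigma> (Suc i) = \<sigma> i / real P"
      using B[of i] i j rzeta_Cons_one[of P "subword w (Suc i) j" Q]
      by (simp add: z_def subword_Cons[of i j] k_def P_def)
  qed (rule \<sigma>0)
  define I where "I = {i. i < k \<and> w ! i = 0}"
  define J where "J = {j. 0 < j \<and> j \<le> k \<and> w ! (j - 1) = 1}"
  have fin: "finite I" "finite J" by (simp_all add: I_def J_def)
  have Ji: "{j. i < j \<and> j \<le> k \<and> w ! (j - 1) = 1} = {j\<in>J. i < j}" for i
    by (auto simp: J_def)
  have Ij: "{i. i < j \<and> w ! i = 0} = {i\<in>I. i < j}" if "j \<in> J" for j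
    using that by (auto simp: J_def I_def)
  \<comment> \<open>The empty word at the final indices. Contributions of the first phase arise at
    the mixed indices \<open>p\<close> and \<open>Q\<close>, which accounts for the ratio
    (P+Q)/P.\<close>
  define c where "c = 1 / real ((P + Q) choose P)"
  have c0: "z i i p Q = c * (real (P + Q) / real P)" "z i i P Q = c" for i
  proof -
    have "real (Suc p) * real ((P + Q) choose P) = real (P + Q) * real ((p + Q) choose p)"
      using arg_cong[OF Suc_times_binomial[of p "p + Q"], of real] unfolding P_def add_Suc of_nat_mult .
    moreover have "(P + Q) choose P > 0" "(p + Q) choose p > 0" "0 < P" by (simp_all add: P_def)
    ultimately show "z i i p Q = c * (real (P + Q) / real P)"
      by (simp add: z_def subword_self rzeta_Nil c_def P_def[symmetric] field_simps del: of_nat_add zero_less_binomial_iff)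
    show "z i i P Q = c" by (simp add: z_def subword_self rzeta_Nil c_def)
  qed
  have "remainder w m n M = (\<Sum>i\<in>I. U i * (\<Sum>j | i < j \<and> j \<le> k \<and> w ! (j - 1) = 1. T j * z i j p q))"
    by (simp add: remainder_def sum_distrib_left I_def k_def U_def T_def z_def p_def q_def mult_ac)
  also have "\<dots> = (\<Sum>i\<in>I. U i * ((\<Sum>j | i < j \<and> j \<le> k \<and> w ! (j - 1) = 1. (T j + \<rho> j) * z i j p Q) + \<rho> i * z i i p Q))"
    by (intro sum.cong refl arg_cong2[of _ _ _ _ times] right) (auto simp: I_def)
  also have "\<dots> = (\<Sum>i\<in>I. \<Sum>j\<in>{j\<in>J. i < j}. (T j + \<rho> j) * (U i * z i j p Q))
      + c * ((\<Sum>i\<in>I. U i * \<rho> i) * (real (P + Q) / real P))"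
    unfolding Ji distrib_left[where 'a=real] sum.distrib sum_distrib_left sum_distrib_right c0
    by (intro arg_cong2[of _ _ _ _ plus] sum.cong refl) (simp_all only: mult_ac)
  \<comment> \<open>The right end must become the outer variable before the left ends can be
    peeled.\<close>
  also have "(\<Sum>i\<in>I. \<Sum>j\<in>{j\<in>J. i < j}. (T j + \<rho> j) * (U i * z i j p Q))
      = (\<Sum>j\<in>J. \<Sum>i\<in>{i\<in>I. i < j}. (T j + \<rho> j) * (U i * z i j p Q))"
    by (rule sum.swap_restrict[OF fin])
  also have "\<dots> = (\<Sum>j\<in>J. (T j + \<rho> j) * ((\<Sum>i\<in>{i\<in>I. i < j}. (U i + \<sigma> i) * z i j P Q) + \<sigma> j * c))"
  proof (intro sum.cong refl)
    fix j assume j: "j \<in> J"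
    then have "j \<le> k" by (simp add: J_def)
    from left[OF this] show "(\<Sum>i\<in>{i\<in>I. i < j}. (T j + \<rho> j) * (U i * z i j p Q))
      = (T j + \<rho> j) * ((\<Sum>i\<in>{i\<in>I. i < j}. (U i + \<sigma> i) * z i j P Q) + \<sigma> j * c)"
      unfolding Ij[OF j] c0 sum_distrib_left[symmetric] by simp
  qed
  also have "\<dots> = (\<Sum>j\<in>J. \<Sum>i\<in>{i\<in>I. i < j}. (U i + \<sigma> i) * (T j + \<rho> j) * z i j P Q)
      + c * (\<Sum>j\<in>J. (T j + \<rho> j) * \<sigma> j)"
    unfolding distrib_left[where 'a=real] sum.distrib sum_distrib_left
    by (intro arg_cong2[of _ _ _ _ plus] sum.cong refl) (simp_all add: algebra_simps)
  also have "(\<Sum>j\<in>J. \<Sum>i\<in>{i\<in>I. i < j}. (U i + \<sigma> i) * (T j + \<rho> j) * z i j P Q)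
      = (\<Sum>i\<in>I. \<Sum>j\<in>{j\<in>J. i < j}. (U i + \<sigma> i) * (T j + \<rho> j) * z i j P Q)"
    by (rule sum.swap_restrict[OF fin, symmetric])
  also have "\<dots> = remainder w m n (Suc M)"
    unfolding remainder_def k_def[symmetric] I_def[symmetric] Ji
    by (simp add: U'[symmetric] T'[symmetric] z_def P_def Q_def p_def q_def)
  finally have "remainder w m n M = remainder w m n (Suc M) + c * ((\<Sum>j\<in>J. (T j + \<rho> j) * \<sigma> j)
      + (\<Sum>i\<in>I. U i * \<rho> i) * (real (P + Q) / real P))"
    by (simp add: ring_distribs)
  also have "(\<Sum>j\<in>J. (T j + \<rho> j) * \<sigma> j) + (\<Sum>i\<in>I. U i * \<rho> i) * (real (P + Q) / real P)
      = (\<Sum>i=1..length w - 1. \<sigma> i * \<rho> i * lam P Q (w ! (i - 1)) (w ! i))"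
    unfolding I_def J_def k_def
  proof (rule sum_products_eq_lam)
    show "\<rho> (length w) = 0" using \<rho>k by (simp add: k_def)
  qed (use A B \<sigma>0 assms in \<open>simp_all add: P_def Q_def k_def\<close>)
  finally show ?thesis
    by (simp add: c_def \<sigma>_def \<rho>_def P_def Q_def p_def q_def mult_2 add_ac)
qed

text \<open>For \<open>M = 0\<close> the truncated sums are empty, so a coefficient survives only if
  nothing lies outside the factor.\<close>

lemma remainder_0:
  assumes "w \<noteq> []" "hd w = 0" "last w = 1"
  shows "remainder w m n 0 = rzeta w m n"
proof -
  define k where "k = length w"
  have k: "0 < k" "w ! 0 = 0" "w ! (k - 1) = 1"
    using assms by (auto simp: k_def hd_conv_nth last_conv_nth)
  let ?t = "\<lambda>i j. tail_sum m (dual_word (take i w)) (m + 0) * tail_sum n (drop j w) (n + 0)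
          * rzeta (subword w i j) (m + 0) (n + 0)"
  have "remainder w m n 0 = (\<Sum>i\<in>{0}. \<Sum>j | i < j \<and> j \<le> k \<and> w ! (j - 1) = 1. ?t i j)"
    unfolding remainder_def k_def[symmetric] using k
    by (intro sum.mono_neutral_right) (auto simp: tail_sum_self dual_word_def assms(1))
  also have "\<dots> = (\<Sum>j | 0 < j \<and> j \<le> k \<and> w ! (j - 1) = 1. ?t 0 j)" by simp
  also have "\<dots> = (\<Sum>j\<in>{k}. ?t 0 j)"
    using k by (intro sum.mono_neutral_right) (auto simp: tail_sum_self k_def)
  also have "\<dots> = rzeta w m n"
    by (simp add: tail_sum_self dual_word_def k_def subword_def)
  finally show ?thesis .
qed

text \<open>A finite sum whose terms are of order (3/2 * 3/2 * 1/4)^M = (9/16)^M: two coefficients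
  against the decay of one zeta value.\<close>

lemma remainder_tendsto_0: "remainder w m n \<longlonglongrightarrow> 0"
  unfolding remainder_def
proof (intro tendsto_null_sum)
  fix i j assume "i \<in> {i. i < length w \<and> w ! i = 0}"
    and "j \<in> {j. i < j \<and> j \<le> length w \<and> w ! (j - 1) = 1}"
  then have i: "i < length w" "w ! i = 0" and j: "i < j" "j \<le> length w" "w ! (j - 1) = 1" by auto
  define x where "x = subword w i j"
  have x: "x \<noteq> []" "hd x = 0" "last x = 1"
    using i j arg_cong[OF subword_Cons[of i j w], of hd] arg_cong[OF subword_snoc[of i j w], of last]
      subword_Cons[of i j w]
    by (simp_all add: x_def)
  define K where "K u = (3::real) ^ (length (u::bit list) + 2)" for u
  define C where "C = K (dual_word (take i w)) * (3/2) ^ m * (K (drop j w) * (3/2) ^ n) * rzeta x m n"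
  have z: "rzeta x (m + M) (n + M) \<le> (1/4) ^ M * rzeta x m n" for M
  proof -
    have fin: "ezeta x m n < top" using x by (intro ezeta_finite) auto
    have "rzeta x (m + M) (n + M) \<le> enn2real (ennreal ((1/4) ^ M) * ezeta x m n)"
      unfolding rzeta_def using fin
      by (intro enn2real_mono ezeta_decay x(1)) (auto simp: ennreal_mult_less_top)
    then show ?thesis by (simp add: enn2real_mult rzeta_def)
  qed
  have "norm (tail_sum m (dual_word (take i w)) (m + M) * tail_sum n (drop j w) (n + M)
          * rzeta x (m + M) (n + M)) \<le> C * (9/16) ^ M" for M
  proof -
    have "tail_sum m (dual_word (take i w)) (m + M) * tail_sum n (drop j w) (n + M) * rzeta x (m + M) (n + M)
        \<le> (K (dual_word (take i w)) * (3/2) ^ (m + M)) * (K (drop j w) * (3/2) ^ (n + M))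
            * ((1/4) ^ M * rzeta x m n)"
      unfolding K_def by (intro mult_mono tail_sum_le z mult_nonneg_nonneg tail_sum_nonneg rzeta_nonneg) auto
    also have "\<dots> = C * ((3/2) ^ M * (3/2) ^ M * (1/4) ^ M)"
      by (simp add: C_def power_add mult_ac)
    also have "(3/2) ^ M * (3/2) ^ M * (1/4) ^ M = (9/16 :: real) ^ M"
      by (simp add: power_mult_distrib[symmetric])
    finally show ?thesis
      by (simp add: tail_sum_nonneg rzeta_nonneg)
  qed
  moreover have "(\<lambda>M. C * (9/16) ^ M) \<longlonglongrightarrow> 0"
    by (intro tendsto_mult_right_zero LIMSEQ_power_zero) auto
  ultimately show "(\<lambda>M. tail_sum m (dual_word (take i w)) (m + M) * tail_sum n (drop j w) (n + M)
          * rzeta (subword w i j) (m + M) (n + M)) \<longlonglongrightarrow> 0"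
    unfolding x_def by (rule Lim_null_comparison[OF always_eventually[OF allI]])
qed

theorem theorem9:
  fixes w :: binary_word and m n :: nat
  assumes "w \<noteq> []" and "admissible w"
  shows "(\<lambda>M'. let M = Suc M' in
            1 / real ((m + n + 2 * M) choose (m + M)) *
            (\<Sum>i=1..length w - 1.
               phi m (m + M) (comp_b w i) * phi n (n + M) (comp_a w i) *
               lam (m + M) (n + M) (w ! (i - 1)) (w ! i)))
         sums zeta_mn w m n"
proof -
  have w: "hd w = 0" "last w = 1" using assms by (auto simp: admissible_def)
  \<comment> \<open>For an inner cut both words are non-empty and end with 1: the suffix because
    \<open>w\<close> does, the dual prefix because \<open>w\<close> starts with 0. Hence both are
    words of compositions.\<close>
  have a: "phi n (n + Suc M) (comp_a w i) = phi_word n (drop i w) (n + Suc M)"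
    if "i \<in> {1..length w - 1}" for i M
    unfolding comp_a_def using that w by (intro phi_word_comp) (auto simp: last_drop)
  have b: "phi m (m + Suc M) (comp_b w i) = phi_word m (dual_word (take i w)) (m + Suc M)"
    if "i \<in> {1..length w - 1}" for i M
    unfolding comp_b_def dual_word_def using that w assms
    by (intro phi_word_comp) (auto simp: last_map last_rev bit_compl_def)
  \<comment> \<open>The series telescopes to the initial remainder, which is the zeta value
    itself.\<close>
  have "(\<lambda>M. remainder w m n M - remainder w m n (Suc M)) sums (remainder w m n 0 - 0)"
    by (rule telescope_sums'[OF remainder_tendsto_0])
  moreover have "remainder w m n 0 - 0 = zeta_mn w m n"
    using assms w by (simp add: remainder_0 zeta_mn_eq_ezeta rzeta_def)
  moreover have "remainder w m n M - remainder w m n (Suc M)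
      = 1 / real ((m + n + 2 * Suc M) choose (m + Suc M)) *
          (\<Sum>i=1..length w - 1.
             phi m (m + Suc M) (comp_b w i) * phi n (n + Suc M) (comp_a w i) *
             lam (m + Suc M) (n + Suc M) (w ! (i - 1)) (w ! i))" for M
  proof -
    have eq: "(\<Sum>i=1..length w - 1.
             phi m (m + Suc M) (comp_b w i) * phi n (n + Suc M) (comp_a w i) *
             lam (m + Suc M) (n + Suc M) (w ! (i - 1)) (w ! i))
        = (\<Sum>i=1..length w - 1.
             phi_word m (dual_word (take i w)) (m + Suc M) * phi_word n (drop i w) (n + Suc M) *
             lam (m + Suc M) (n + Suc M) (w ! (i - 1)) (w ! i))"
      by (intro sum.cong refl) (simp only: a b)
    show ?thesis
      unfolding eq diff_eq_eq by (rule trans[OF remainder_step[OF assms(1)] add.commute])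
  qed
  ultimately show ?thesis by (simp only: Let_def)
qed

end
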